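(* Let $H$ be a real Hilbert space. (i) Let $E\colon H\to(-\infty,\infty]$ be convex, proper and lower semicontinuous. Then, setting $$J_\lambda(f)=\operatorname*{argmin}_{g\in H}\Big[\tfrac1{2\lambda}\|f-g\|^2+E(g)\Big]\quad(\lambda>0),\qquad J_0=P_{\overline{D(E)}},$$ defines a strongly continuous non-expansive non-linear resolvent $J_\bullet\colon H\to H$ on $\overline{D(E)}$, generated by $\partial E$ (that is, $J_\lambda=(I_H+\lambda\,\partial E)^{-1}$ for all $\lambda>0$), and such that $I_H-J_\lambda$ is cyclically monotone for every $\lambda>0$. (ii) Vice versa, let $C$ be a non-empty closed convex subset of $H$, and let $J_\bullet\colon H\to H$ be a strongly continuous non-expansive non-linear resolvent on $C$ such that $I_H-J_\lambda$ is cyclically monotone for every $\lambda>0$. Fix $f_0\in H$ with $\limsup_{\lambda\downarrow0}\|\tfrac1\lambda(f_0-J_\lambda(f_0))\|<\infty$, and for $\lambda>0$ let $E^\lambda$ be the cyclical envelope of $A_\lambda=\tfrac1\lambda(I_H-J_\lambda)$ based at $(f_0,A_\lambda(f_0))$. Then $$D(E)=\Big\{f\in C:\ \lim_{\lambda\to0}E^\lambda(f)\text{ exists and is }<\infty\Big\},\qquad E(f)=\lim_{\lambda\to0}E^\lambda(f)\ \ (f\in D(E)),$$ (with $E=+\infty$ outside $D(E)$) is well defined and is a proper convex lower semicontinuous functional $E\colon H\to(-\infty,\infty]$, and $J_\bullet$ is generated by $\partial E$, i.e. $J_\lambda=(I_H+\lambda\,\partial E)^{-1}$ for all $\lambda>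0$.
   Context: $D(E)=\{f:E(f)<\infty\}$; proper means $D(E)\neq\emptyset$. $P_K$ is the metric projection onto a closed convex set $K$. $\partial E(f)=\{v\in H:E(g)-E(f)\ge\langle v|g-f\rangle\ \forall g\in D(E)\}$ for $f\in D(E)$. $J_\bullet=(J_\lambda)_{\lambda\ge0}$, $J_\lambda\colon H\to H$, is a strongly continuous non-expansive non-linear resolvent on a non-empty closed convex set $C$ if: $J_0=P_C$; $J_\lambda=J_\mu\circ\big(\tfrac\mu\lambda I_H+(1-\tfrac\mu\lambda)J_\lambda\big)$ for all $\lambda>0$, $\mu\ge0$; $\lim_{\lambda\to0}\|J_\lambda(f)-P_C(f)\|=0$ for all $f\in H$; $\|J_\lambda(f)-J_\lambda(g)\|\le\|f-g\|$ for all $f,g\in H$, $\lambda\ge0$. A (single-valued) operator $B\colon H\to H$ is cyclically monotone if $\sum_{i=1}^n\langle f_i-f_{i-1}|B(f_i)\rangle\ge0$ for all $n$ and $f_1,\dots,f_n\in H$, with $f_0:=f_n$. For such $B$ and $f_0\in H$, the cyclical envelope of $B$ based at $(f_0,B(f_0))$ is the function $$f\mapsto\sup\Big\{\sum_{i=0}^n\langle f_{i+1}-f_i|B(f_i)\rangle:\ n\in\mathbb N_0,\ f_1,\dots,f_n\in H,\ f_{n+1}:=f\Big\}.$$ *)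

theory Defs
  imports "HOL-Analysis.Analysis"
begin

text \<open>Real Hilbert spaces are rendered by the sort \<open>{real_inner, complete_space}\<close>. Functionals are
  \<open>ereal\<close>-valued; that they avoid the value \<open>-\<infinity>\<close> is always stated separately.\<close>

definition eff_domain :: "('a \<Rightarrow> ereal) \<Rightarrow> 'a set" where
  "eff_domain E = {f. E f < \<infinity>}"

definition proper_functional :: "('a \<Rightarrow> ereal) \<Rightarrow> bool" where
  "proper_functional E \<longleftrightarrow> eff_domain E \<noteq> {}"

definition convex_functional :: "('a::real_vector \<Rightarrow> ereal) \<Rightarrow> bool" where
  "convex_functional E \<longleftrightarrow>
     (\<forall>f g. \<forall>t\<in>{0..1}. E ((1 - t) *\<^sub>R f + t *\<^sub>R g) \<le> ereal (1 - t) * E f + ereal t * E g)"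

definition lsc_functional :: "('a::topological_space \<Rightarrow> ereal) \<Rightarrow> bool" where
  "lsc_functional E \<longleftrightarrow> (\<forall>f. E f \<le> Liminf (at f) E)"

text \<open>The library's \<open>closest_point\<close> is restricted to Heine-Borel (finite-dimensional) spaces.\<close>

definition metric_proj :: "'a::metric_space set \<Rightarrow> 'a \<Rightarrow> 'a" where
  "metric_proj K f = arg_min_on (dist f) K"

text \<open>Multi-valued operators on \<open>H\<close> are identified with their graphs.\<close>

definition subdifferential :: "('a::real_inner \<Rightarrow> ereal) \<Rightarrow> ('a \<times> 'a) set" where
  "subdifferential E =
     {(f, v). f \<in> eff_domain E \<and> (\<forall>g\<in>eff_domain E. E g - E f \<ge> ereal (v \<bullet> (g - f)))}"

definition nonexp_resolvent ::
    "'a::{real_inner, complete_space} set \<Rightarrow> (real \<Rightarrow> 'a \<Rightarrow> 'a) \<Rightarrow> bool" where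
  "nonexp_resolvent C J \<longleftrightarrow>
     C \<noteq> {} \<and> closed C \<and> convex C \<and>
     J 0 = metric_proj C \<and>
     (\<forall>l>0. \<forall>m\<ge>0. J l = J m \<circ> (\<lambda>f. (m / l) *\<^sub>R f + (1 - m / l) *\<^sub>R J l f)) \<and>
     (\<forall>f. ((\<lambda>l. norm (J l f - metric_proj C f)) \<longlongrightarrow> 0) (at_right 0)) \<and>
     (\<forall>l\<ge>0. \<forall>f g. norm (J l f - J l g) \<le> norm (f - g))"

text \<open>\<open>J\<^sub>\<lambda> = (I + \<lambda> A)\<inverse>\<close> for all \<open>\<lambda> > 0\<close>, as an equality of graphs.\<close>

definition generated_by :: "(real \<Rightarrow> 'a::real_vector \<Rightarrow> 'a) \<Rightarrow> ('a \<times> 'a) set \<Rightarrow> bool" where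
  "generated_by J A \<longleftrightarrow> (\<forall>l>0. {(f, J l f) |f. True} = {(g, g + l *\<^sub>R v) |g v. (g, v) \<in> A}\<inverse>)"

definition cyclically_monotone :: "('a::real_inner \<Rightarrow> 'a) \<Rightarrow> bool" where
  "cyclically_monotone B \<longleftrightarrow>
     (\<forall>n (f :: nat \<Rightarrow> 'a). f 0 = f n \<longrightarrow> (\<Sum>i=1..n. (f i - f (i - 1)) \<bullet> B (f i)) \<ge> 0)"

definition cyclical_envelope :: "('a::real_inner \<Rightarrow> 'a) \<Rightarrow> 'a \<Rightarrow> 'a \<Rightarrow> ereal" where
  "cyclical_envelope B f0 f =
     (SUP (n, h) \<in> {(n :: nat, h :: nat \<Rightarrow> 'a). h 0 = f0 \<and> h (Suc n) = f}.
        ereal (\<Sum>i=0..n. (h (Suc i) - h i) \<bullet> B (h i)))"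

definition prox_objective :: "('a::real_normed_vector \<Rightarrow> ereal) \<Rightarrow> real \<Rightarrow> 'a \<Rightarrow> 'a \<Rightarrow> ereal" where
  "prox_objective E l f g = ereal (1 / (2 * l) * (norm (f - g))\<^sup>2) + E g"

text \<open>Only the values at \<open>l \<ge> 0\<close> are meaningful.\<close>

definition prox :: "('a::real_normed_vector \<Rightarrow> ereal) \<Rightarrow> real \<Rightarrow> 'a \<Rightarrow> 'a" where
  "prox E l f = (if l = 0 then metric_proj (closure (eff_domain E)) f
                 else (ARG_MIN (prox_objective E l f) g. True))"

definition approximant :: "(real \<Rightarrow> 'a::real_vector \<Rightarrow> 'a) \<Rightarrow> real \<Rightarrow> 'a \<Rightarrow> 'a" where
  "approximant J l f = (1 / l) *\<^sub>R (f - J l f)"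

text \<open>The limit of \<open>F l f\<close> as \<open>l\<close> decreases to \<open>0\<close> is taken in the extended reals.\<close>

definition limit_functional :: "'a set \<Rightarrow> (real \<Rightarrow> 'a \<Rightarrow> ereal) \<Rightarrow> 'a \<Rightarrow> ereal" where
  "limit_functional C F f =
     (if f \<in> C \<and> (\<exists>c<\<infinity>. ((\<lambda>l. F l f) \<longlongrightarrow> c) (at_right 0))
      then Lim (at_right 0) (\<lambda>l. F l f) else \<infinity>)"

end

theory Submission
  imports Defs
begin

text \<open>Part (i): the proximal objective is strongly convex and, by a linear lower bound on \<open>E\<close>, bounded
  below, so it has a unique minimiser, and \<open>g = J\<^sub>\<lambda> f\<close> means \<open>(f - g)/\<lambda> \<in> \<partial>E(g)\<close>. Monotonicity of
  \<open>\<partial>E\<close> gives non-expansiveness, and \<open>I - J\<^sub>\<lambda>\<close> is cyclically monotone as \<open>\<lambda>\<close> times the gradient of the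
  Moreau envelope of \<open>E\<close>.

  Part (ii): by the resolvent identity the pairs \<open>(J\<^sub>\<lambda> f, (f - J\<^sub>\<lambda> f)/\<lambda>)\<close> form a graph \<open>A\<close> that does
  not depend on \<open>\<lambda>\<close>, and letting \<open>\<lambda> \<rightarrow> 0\<close> shows that \<open>A\<close> is cyclically monotone. Rockafellar's potential
  \<open>E'\<close> of \<open>A\<close> satisfies \<open>A \<subseteq> \<partial>E'\<close>, so \<open>J\<close> is the resolvent of \<open>\<partial>E'\<close>. The cyclical envelope of
  \<open>A\<^sub>\<lambda>\<close> equals the Moreau envelope of \<open>E'\<close> minus its value at \<open>f0\<close>, since both have the Lipschitz
  gradient \<open>A\<^sub>\<lambda>\<close>, and Moreau envelopes converge to \<open>E'\<close> on \<open>C\<close>. Hence \<open>E = E' - E'(f0)\<close>; the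
  boundedness hypothesis on \<open>f0\<close> guarantees \<open>E'(f0) < \<infinity>\<close>.\<close>

section \<open>Lower semicontinuity and convexity of extended-real functionals\<close>

text \<open>\<open>Liminf (at f)\<close> ignores the value at \<open>f\<close> itself, but
  \<open>y < E f\<close> holds there by assumption, so the punctured filter may be replaced by
  \<open>nhds f\<close>.\<close>

lemma lsc_functional_iff:
  "lsc_functional E \<longleftrightarrow> (\<forall>f. \<forall>y<E f. eventually (\<lambda>x. y < E x) (nhds f))"
  unfolding lsc_functional_def le_Liminf_iff
  by (auto simp: eventually_nhds_conv_at)

text \<open>The filter is arbitrary because this serves both minimising sequences and limits along
  \<open>at_right 0\<close>.\<close>

lemma lsc_functional_le_lim:
  assumes "lsc_functional E" "(X \<longlongrightarrow> f) F" "F \<noteq> bot"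
    "eventually (\<lambda>n. E (X n) \<le> c n) F" "(c \<longlongrightarrow> c0) F"
  shows "E f \<le> c0"
proof (rule dense_le)
  fix y assume "y < E f"
  then have "eventually (\<lambda>x. y < E x) (nhds f)"
    using assms(1) by (simp add: lsc_functional_iff)
  then have "eventually (\<lambda>n. y < E (X n)) F"
    using assms(2) by (rule eventually_compose_filterlim)
  then have "eventually (\<lambda>n. y \<le> c n) F"
    using assms(4) by eventually_elim (metis less_imp_le less_le_trans)
  then show "y \<le> c0"
    using assms(3,5) tendsto_lowerbound by blast
qed

text \<open>As \<open>0 * \<infinity> = 0\<close> in \<open>ereal\<close>, the endpoints
  \<open>t = 0\<close> and \<open>t = 1\<close> are trivial; for \<open>t\<close> in between, an
  infinite value makes the right side infinite. Only finite values remain.\<close>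

lemma convex_functionalI:
  fixes E :: "'a::real_vector \<Rightarrow> ereal"
  assumes ninf: "\<And>f. E f \<noteq> -\<infinity>"
    and conv: "\<And>f g a b t. E f = ereal a \<Longrightarrow> E g = ereal b \<Longrightarrow> 0 < t \<Longrightarrow> t < 1 \<Longrightarrow>
      E ((1 - t) *\<^sub>R f + t *\<^sub>R g) \<le> ereal ((1 - t) * a + t * b)"
  shows "convex_functional E"
  unfolding convex_functional_def
proof (intro allI ballI)
  fix f g and t :: real assume t: "t \<in> {0..1}"
  show "E ((1 - t) *\<^sub>R f + t *\<^sub>R g) \<le> ereal (1 - t) * E f + ereal t * E g"
  proof (cases "t = 0 \<or> t = 1")
    case True
    then show ?thesis by (auto simp flip: zero_ereal_def one_ereal_def)
  next
    case False
    with t have "0 < t" "t < 1" by auto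
    then show ?thesis
      using ninf[of f] ninf[of g] conv[of f _ g _ t]
      by (cases "E f"; cases "E g") auto
  qed
qed

section \<open>Proper convex lower semicontinuous functionals and their subdifferentials\<close>

locale convex_lsc =
  fixes E :: "'a::{real_inner, complete_space} \<Rightarrow> ereal"
  assumes not_minf: "E f \<noteq> -\<infinity>"
    and convexE: "convex_functional E"
    and properE: "proper_functional E"
    and lscE: "lsc_functional E"
begin

abbreviation D :: "'a set" where "D \<equiv> eff_domain E"

text \<open>\<open>real_of_ereal\<close> sends \<infinity> to 0, so \<open>e\<close> is meaningful
  only on \<open>D\<close>; hence the membership hypotheses below.\<close>

abbreviation e :: "'a \<Rightarrow> real" where "e f \<equiv> real_of_ereal (E f)"

lemma E_eq: "f \<in> D \<Longrightarrow> E f = ereal (e f)"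
  using not_minf[of f] by (cases "E f") (auto simp: eff_domain_def)

lemma D_iff: "f \<in> D \<longleftrightarrow> (\<exists>a. E f \<le> ereal a)"
  using not_minf[of f] by (cases "E f") (auto simp: eff_domain_def)

lemma D_nonempty: "D \<noteq> {}"
  using properE by (simp add: proper_functional_def)

lemma convexD:
  assumes "f \<in> D" "g \<in> D" "0 \<le> t" "t \<le> 1"
  shows "(1 - t) *\<^sub>R f + t *\<^sub>R g \<in> D"
    and "e ((1 - t) *\<^sub>R f + t *\<^sub>R g) \<le> (1 - t) * e f + t * e g"
proof -
  have "E ((1 - t) *\<^sub>R f + t *\<^sub>R g) \<le> ereal (1 - t) * E f + ereal t * E g"
    using convexE assms unfolding convex_functional_def by auto
  also have "\<dots> = ereal ((1 - t) * e f + t * e g)"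
    by (subst (1 2) E_eq) (use assms in auto)
  finally have *: "E ((1 - t) *\<^sub>R f + t *\<^sub>R g) \<le> ereal ((1 - t) * e f + t * e g)" .
  then show 1: "(1 - t) *\<^sub>R f + t *\<^sub>R g \<in> D" using D_iff by blast
  show "e ((1 - t) *\<^sub>R f + t *\<^sub>R g) \<le> (1 - t) * e f + t * e g"
    using * E_eq[OF 1] by (metis ereal_less_eq(3))
qed

lemma convex_D: "convex D"
  using convexD(1) by (auto simp: convex_alt)

lemma subdifferential_iff:
  "(f, v) \<in> subdifferential E \<longleftrightarrow> f \<in> D \<and> (\<forall>g\<in>D. v \<bullet> (g - f) \<le> e g - e f)"
proof -
  have "E g - E f \<ge> ereal (v \<bullet> (g - f)) \<longleftrightarrow> v \<bullet> (g - f) \<le> e g - e f" if "f \<in> D" "g \<in> D" for g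
    by (subst (1 2) E_eq) (use that in auto)
  then show ?thesis by (auto simp: subdifferential_def)
qed

text \<open>Lower semicontinuity at one point of the domain bounds \<open>E\<close> from below on a ball, and convexity
  propagates this along rays; this replaces the Hahn--Banach argument for an affine minorant.\<close>

lemma linear_growth:
  "\<exists>a b. b \<ge> 0 \<and> (\<forall>g\<in>D. e g \<ge> - a - b * norm (f - g))"
proof -
  obtain u where u: "u \<in> D" using D_nonempty by blast
  have "ereal (e u - 1) < E u" by (subst E_eq[OF u]) simp
  then have "eventually (\<lambda>x. ereal (e u - 1) < E x) (nhds u)"
    using lscE by (simp add: lsc_functional_iff)
  then obtain r where r: "r > 0" "\<And>x. dist x u < r \<Longrightarrow> ereal (e u - 1) < E x"
    unfolding eventually_nhds_metric by blast
  have r': "e u - 1 < e x" if "x \<in> D" "dist x u < r" for x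
    using r(2)[OF that(2)] E_eq[OF that(1)] by (metis less_ereal.simps(1))
  have grow: "e g \<ge> e u - 1 - 2 / r * norm (g - u)" if g: "g \<in> D" for g
  proof (cases "dist g u < r")
    case True
    have "2 / r * norm (g - u) \<ge> 0" using r by simp
    then show ?thesis using r'[OF g True] by linarith
  next
    case False
    define N where "N = norm (g - u)"
    have N: "N \<ge> r" "N > 0" using False r by (auto simp: N_def dist_norm)
    \<comment> \<open>This puts the point at parameter \<open>t\<close> between \<open>u\<close> and
      \<open>g\<close> at distance \<open>r / 2\<close> from \<open>u\<close>, inside the ball.
      Convexity then bounds the drop \<open>e u - e g\<close> by \<open>1 / t\<close>, which is
      linear in \<open>N\<close>.\<close>
    define t where "t = r / (2 * N)"
    have t: "0 < t" "t \<le> 1" using N r by (auto simp: t_def field_simps)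
    have "(1 - t) *\<^sub>R u + t *\<^sub>R g - u = t *\<^sub>R (g - u)" by (simp add: algebra_simps)
    then have "dist ((1 - t) *\<^sub>R u + t *\<^sub>R g) u = t * N"
      using t by (simp add: dist_norm N_def)
    also have "\<dots> < r" using N r by (simp add: t_def)
    finally have "e u - 1 < (1 - t) * e u + t * e g"
      using r'[of "(1 - t) *\<^sub>R u + t *\<^sub>R g"] convexD[OF u g, of t] t by force
    then have "t * (e u - e g) < 1" by (simp add: algebra_simps)
    then have "e u - e g < 1 / t" using t by (simp add: field_simps)
    also have "1 / t = 2 / r * N" by (simp add: t_def)
    finally show ?thesis by (simp add: N_def)
  qed
  have "e g \<ge> - (1 - e u + 2 / r * norm (f - u)) - 2 / r * norm (f - g)" if "g \<in> D" for g
  proof -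
    have "norm (g - u) \<le> norm (f - u) + norm (f - g)"
      using norm_triangle_ineq4[of "f - u" "f - g"] by simp
    then have "2 / r * norm (g - u) \<le> 2 / r * (norm (f - u) + norm (f - g))"
      using r by (intro mult_left_mono) auto
    then show ?thesis using grow[OF that] by (simp add: algebra_simps)
  qed
  then show ?thesis using r by (intro exI[of _ "1 - e u + 2 / r * norm (f - u)"] exI[of _ "2 / r"]) auto
qed

section \<open>Existence, uniqueness and subdifferential characterisation of proximal points\<close>

lemma prox_objective_eq:
  "g \<in> D \<Longrightarrow> prox_objective E l f g = ereal (1 / (2 * l) * (norm (f - g))\<^sup>2 + e g)"
  unfolding prox_objective_def by (subst E_eq) auto

lemma prox_objective_infty: "g \<notin> D \<Longrightarrow> prox_objective E l f g = \<infinity>"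
  by (auto simp: prox_objective_def eff_domain_def)

text \<open>Properness supplies a competitor of finite value, so a minimiser cannot lie outside
  \<open>D\<close>; minimality becomes a statement about real numbers.\<close>

lemma is_arg_min_prox_iff:
  "is_arg_min (prox_objective E l f) (\<lambda>_. True) g \<longleftrightarrow>
     g \<in> D \<and> (\<forall>h\<in>D. 1 / (2 * l) * (norm (f - g))\<^sup>2 + e g \<le> 1 / (2 * l) * (norm (f - h))\<^sup>2 + e h)"
    (is "?L \<longleftrightarrow> ?R")
proof
  assume L: ?L
  then have min: "prox_objective E l f g \<le> prox_objective E l f h" for h
    by (auto simp: is_arg_min_def not_less)
  have g: "g \<in> D"
  proof (rule ccontr)
    assume "g \<notin> D"
    obtain u where "u \<in> D" using D_nonempty by blast
    with min[of u] \<open>g \<notin> D\<close> show False by (simp add: prox_objective_eq prox_objective_infty)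
  qed
  show ?R
  proof (intro conjI ballI g)
    fix h assume "h \<in> D"
    with min[of h] g show "1 / (2 * l) * (norm (f - g))\<^sup>2 + e g \<le> 1 / (2 * l) * (norm (f - h))\<^sup>2 + e h"
      by (simp add: prox_objective_eq)
  qed
next
  assume R: ?R
  show ?L unfolding is_arg_min_def
  proof (intro conjI TrueI notI, elim exE conjE)
    fix y assume "prox_objective E l f y < prox_objective E l f g"
    then show False using R
      by (cases "y \<in> D") (force simp: prox_objective_eq prox_objective_infty)+
  qed
qed

text \<open>Direct method in the norm topology: the parallelogram identity makes a minimising
  sequence Cauchy, and lower semicontinuity identifies its limit as a minimiser.\<close>

lemma ex_is_arg_min_prox:
  assumes l: "l > 0"
  shows "\<exists>g. is_arg_min (prox_objective E l f) (\<lambda>_. True) g"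
proof -
  define \<Phi> where "\<Phi> g = 1 / (2 * l) * (norm (f - g))\<^sup>2 + e g" for g
  obtain a b where ab: "b \<ge> 0" "\<And>g. g \<in> D \<Longrightarrow> e g \<ge> - a - b * norm (f - g)"
    using linear_growth[of f] by blast
  have "\<Phi> g \<ge> - a - l * b\<^sup>2 / 2" if "g \<in> D" for g
  proof -
    \<comment> \<open>Completing the square absorbs the linear lower bound on \<open>E\<close> into
      the quadratic term.\<close>
    have "(norm (f - g) - l * b)\<^sup>2 / (2 * l) \<ge> 0" using l by simp
    also have "(norm (f - g) - l * b)\<^sup>2 / (2 * l)
        = 1 / (2 * l) * (norm (f - g))\<^sup>2 - b * norm (f - g) + l * b\<^sup>2 / 2"
      using l by (simp add: field_simps power2_eq_square)
    finally show ?thesis using ab(2)[OF that] by (simp add: \<Phi>_def)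
  qed
  then have bdd: "bdd_below (\<Phi> ` D)" by (auto simp: bdd_below_def)
  define m where "m = Inf (\<Phi> ` D)"
  have m: "m \<le> \<Phi> g" if "g \<in> D" for g
    unfolding m_def using bdd that by (intro cInf_lower) auto
  have "\<exists>g\<in>D. \<Phi> g < m + 1 / real (Suc n)" for n
    using cInf_less_iff[OF _ bdd, of "m + 1 / real (Suc n)"] D_nonempty by (auto simp: m_def)
  then obtain G where G: "\<And>n. G n \<in> D" "\<And>n. \<Phi> (G n) < m + 1 / real (Suc n)"
    by metis
  \<comment> \<open>Compares the infimum \<open>m\<close> with the value at the midpoint: two points
    whose values are both close to \<open>m\<close> must be close to each other.\<close>
  have par: "(norm (x - y))\<^sup>2 \<le> 4 * l * ((\<Phi> x - m) + (\<Phi> y - m))" if "x \<in> D" "y \<in> D" for x y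
  proof -
    define z where "z = (1 - 1/2) *\<^sub>R x + (1/2::real) *\<^sub>R y"
    have z: "z \<in> D" "e z \<le> e x / 2 + e y / 2"
      unfolding z_def using convexD[OF that, of "1/2"] by auto
    have "(norm (f - z))\<^sup>2 = (norm (f - x))\<^sup>2 / 2 + (norm (f - y))\<^sup>2 / 2 - (norm (x - y))\<^sup>2 / 4"
      by (simp add: z_def power2_norm_eq_inner inner_diff inner_add inner_commute field_simps)
    then have "1 / (2 * l) * (norm (f - z))\<^sup>2 = 1 / (2 * l) * (norm (f - x))\<^sup>2 / 2
        + 1 / (2 * l) * (norm (f - y))\<^sup>2 / 2 - (norm (x - y))\<^sup>2 / (8 * l)"
      by (simp add: diff_divide_distrib add_divide_distrib)
    then have "\<Phi> z \<le> (\<Phi> x + \<Phi> y) / 2 - (norm (x - y))\<^sup>2 / (8 * l)"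
      using z(2) unfolding \<Phi>_def by (simp add: add_divide_distrib)
    with m[OF z(1)] have "(norm (x - y))\<^sup>2 / (8 * l) \<le> (\<Phi> x + \<Phi> y) / 2 - m" by linarith
    then show ?thesis using l by (simp add: field_simps)
  qed
  have "Cauchy G"
  proof (rule CauchyI)
    fix \<epsilon> :: real assume \<epsilon>: "\<epsilon> > 0"
    obtain M where M: "1 / real (Suc M) < \<epsilon>\<^sup>2 / (8 * l)"
      using nat_approx_posE[of "\<epsilon>\<^sup>2 / (8 * l)"] \<epsilon> l by auto
    have small: "\<Phi> (G i) - m < \<epsilon>\<^sup>2 / (8 * l)" if "i \<ge> M" for i
    proof -
      have "1 / real (Suc i) \<le> 1 / real (Suc M)" using that by (simp add: frac_le)
      then show ?thesis using G(2)[of i] M by linarith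
    qed
    show "\<exists>M. \<forall>i\<ge>M. \<forall>j\<ge>M. norm (G i - G j) < \<epsilon>"
    proof (intro exI allI impI)
      fix i j assume ij: "i \<ge> M" "j \<ge> M"
      have "4 * l * ((\<Phi> (G i) - m) + (\<Phi> (G j) - m)) < 4 * l * (\<epsilon>\<^sup>2 / (8 * l) + \<epsilon>\<^sup>2 / (8 * l))"
        using l small[OF ij(1)] small[OF ij(2)] by (intro mult_strict_left_mono) auto
      also have "\<dots> = \<epsilon>\<^sup>2" using l by (simp add: field_simps)
      finally have "(norm (G i - G j))\<^sup>2 < \<epsilon>\<^sup>2" using par[OF G(1) G(1)] by (meson le_less_trans)
      then show "norm (G i - G j) < \<epsilon>" using \<epsilon> power_less_imp_less_base by fastforce
    qed
  qed
  then obtain g where g: "G \<longlonglongrightarrow> g" using Cauchy_convergent convergent_def by blast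
  \<comment> \<open>Lower semicontinuity concerns \<open>E\<close> alone, so the continuous
    quadratic term is moved into the bound.\<close>
  define c where "c n = m + 1 / real (Suc n) - 1 / (2 * l) * (norm (f - G n))\<^sup>2" for n
  have "(\<lambda>n. 1 / real (Suc n)) \<longlonglongrightarrow> 0"
    using LIMSEQ_inverse_real_of_nat by (simp add: inverse_eq_divide)
  then have "c \<longlonglongrightarrow> m + 0 - 1 / (2 * l) * (norm (f - g))\<^sup>2"
    unfolding c_def by (intro tendsto_intros g)
  then have lim: "(\<lambda>n. ereal (c n)) \<longlonglongrightarrow> ereal (m - 1 / (2 * l) * (norm (f - g))\<^sup>2)" by simp
  have le: "E (G n) \<le> ereal (c n)" for n
    using G(2)[of n] by (subst E_eq[OF G(1)]) (simp add: c_def \<Phi>_def)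
  have Eg: "E g \<le> ereal (m - 1 / (2 * l) * (norm (f - g))\<^sup>2)"
    by (rule lsc_functional_le_lim[OF lscE g _ _ lim]) (use le in auto)
  then have gD: "g \<in> D" using D_iff by blast
  have "\<Phi> g \<le> m" using Eg E_eq[OF gD] unfolding \<Phi>_def
    by (metis ereal_less_eq(3) le_diff_eq add.commute)
  then show ?thesis using gD m unfolding is_arg_min_prox_iff \<Phi>_def by force
qed

text \<open>Forward: move from \<open>g\<close> towards \<open>h\<close> by a fraction
  \<open>t\<close>, divide the minimality inequality by \<open>t\<close> and let \<open>t\<close>
  tend to 0. Backward: expand the square around \<open>g\<close> and drop the nonnegative term in
  \<open>h - g\<close>.\<close>

lemma is_arg_min_prox_iff_subdifferential:
  assumes l: "l > 0"
  shows "is_arg_min (prox_objective E l f) (\<lambda>_. True) g \<longleftrightarrow> (g, (1 / l) *\<^sub>R (f - g)) \<in> subdifferential E"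
    (is "?L \<longleftrightarrow> ?R")
proof
  assume ?L
  then have g: "g \<in> D" and
    min: "\<And>h. h \<in> D \<Longrightarrow> 1 / (2 * l) * (norm (f - g))\<^sup>2 + e g \<le> 1 / (2 * l) * (norm (f - h))\<^sup>2 + e h"
    by (auto simp: is_arg_min_prox_iff)
  have "((1 / l) *\<^sub>R (f - g)) \<bullet> (h - g) \<le> e h - e g" if h: "h \<in> D" for h
  proof -
    have le: "((1 / l) *\<^sub>R (f - g)) \<bullet> (h - g) \<le> e h - e g + t * ((norm (h - g))\<^sup>2 / (2 * l))"
      if t: "0 < t" "t < 1" for t :: real
    proof -
      define x where "x = (1 - t) *\<^sub>R g + t *\<^sub>R h"
      have x: "x \<in> D" "e x \<le> (1 - t) * e g + t * e h"
        unfolding x_def using convexD[OF g h, of t] t by auto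
      have "f - x = (f - g) - t *\<^sub>R (h - g)" by (simp add: x_def algebra_simps)
      then have "(f - x) \<bullet> (f - x) = ((f - g) - t *\<^sub>R (h - g)) \<bullet> ((f - g) - t *\<^sub>R (h - g))"
        by (simp only:)
      then have "(norm (f - x))\<^sup>2 = (norm (f - g))\<^sup>2 - 2 * t * ((f - g) \<bullet> (h - g)) + t\<^sup>2 * (norm (h - g))\<^sup>2"
        unfolding power2_norm_eq_inner inner_diff_left[of "f - g"] inner_diff_right[of _ "f - g"]
        by (simp add: inner_commute[of "h - g" "f - g"] power2_eq_square)
      with min[OF x(1)] x(2)
      have "0 \<le> t * (e h - e g) + 1 / (2 * l) * (t\<^sup>2 * (norm (h - g))\<^sup>2 - 2 * t * ((f - g) \<bullet> (h - g)))"
        by (simp add: algebra_simps)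
      also have "\<dots> = t * (e h - e g + t * ((norm (h - g))\<^sup>2 / (2 * l)) - ((1 / l) *\<^sub>R (f - g)) \<bullet> (h - g))"
        unfolding inner_scaleR_left using l by (simp add: right_diff_distrib distrib_left diff_divide_distrib power2_eq_square)
      finally show ?thesis using t by (simp add: zero_le_mult_iff)
    qed
    show ?thesis
    proof (rule tendsto_lowerbound)
      show "((\<lambda>t. e h - e g + t * ((norm (h - g))\<^sup>2 / (2 * l))) \<longlongrightarrow> e h - e g) (at_right 0)"
        using l by (auto intro!: tendsto_eq_intros)
      show "eventually (\<lambda>t. ((1 / l) *\<^sub>R (f - g)) \<bullet> (h - g) \<le> e h - e g + t * ((norm (h - g))\<^sup>2 / (2 * l)))
          (at_right 0)"
        using le by (auto simp: eventually_at_right_field intro!: exI[of _ 1])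
    qed simp
  qed
  then show ?R using g by (simp add: subdifferential_iff)
next
  assume ?R
  then have g: "g \<in> D" and sub: "\<And>h. h \<in> D \<Longrightarrow> ((1 / l) *\<^sub>R (f - g)) \<bullet> (h - g) \<le> e h - e g"
    by (auto simp: subdifferential_iff)
  have "1 / (2 * l) * (norm (f - g))\<^sup>2 + e g \<le> 1 / (2 * l) * (norm (f - h))\<^sup>2 + e h" if "h \<in> D" for h
  proof -
    have "(norm (f - h))\<^sup>2 = (norm (f - g))\<^sup>2 - 2 * ((f - g) \<bullet> (h - g)) + (norm (h - g))\<^sup>2"
      by (simp add: power2_norm_eq_inner inner_diff_left inner_diff_right inner_commute algebra_simps)
    then have "1 / (2 * l) * (norm (f - h))\<^sup>2 = 1 / (2 * l) * (norm (f - g))\<^sup>2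
        - ((1 / l) *\<^sub>R (f - g)) \<bullet> (h - g) + (norm (h - g))\<^sup>2 / (2 * l)"
      unfolding inner_scaleR_left using l by (simp add: field_simps)
    moreover have "(norm (h - g))\<^sup>2 / (2 * l) \<ge> 0" using l by simp
    ultimately show ?thesis using sub[OF that] by linarith
  qed
  then show ?L using g by (simp add: is_arg_min_prox_iff)
qed

lemma subdifferential_monotone:
  assumes "(f, v) \<in> subdifferential E" "(g, w) \<in> subdifferential E"
  shows "0 \<le> (v - w) \<bullet> (f - g)"
proof -
  have "v \<bullet> (g - f) \<le> e g - e f" "w \<bullet> (f - g) \<le> e f - e g"
    using assms by (auto simp: subdifferential_iff)
  then show ?thesis by (simp add: inner_diff algebra_simps)
qed

text \<open>Monotonicity applied to two minimisers \<open>g\<close> and \<open>h\<close> gives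
  \<open>- (1 / l) * ((g - h) \<bullet> (g - h)) \<ge> 0\<close>.\<close>

lemma ex1_is_arg_min_prox:
  assumes l: "l > 0"
  shows "\<exists>!g. is_arg_min (prox_objective E l f) (\<lambda>_. True) g"
proof (rule ex_ex1I[OF ex_is_arg_min_prox[OF l]])
  fix g h assume "is_arg_min (prox_objective E l f) (\<lambda>_. True) g"
    "is_arg_min (prox_objective E l f) (\<lambda>_. True) h"
  then have "0 \<le> ((1 / l) *\<^sub>R (f - g) - (1 / l) *\<^sub>R (f - h)) \<bullet> (g - h)"
    using l by (intro subdifferential_monotone) (auto simp: is_arg_min_prox_iff_subdifferential)
  also have "(1 / l) *\<^sub>R (f - g) - (1 / l) *\<^sub>R (f - h) = (- (1 / l)) *\<^sub>R (g - h)"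
    by (simp add: algebra_simps)
  finally have "(g - h) \<bullet> (g - h) \<le> 0" using l by (simp add: divide_le_0_iff)
  then have "(g - h) \<bullet> (g - h) = 0" by (intro order_antisym inner_ge_zero)
  then show "g = h" by simp
qed

text \<open>\<open>ARG_MIN\<close> is a choice operator; unique existence makes its value
  determinate.\<close>

lemma prox_eq_iff:
  assumes l: "l > 0"
  shows "prox E l f = g \<longleftrightarrow> (g, (1 / l) *\<^sub>R (f - g)) \<in> subdifferential E"
proof -
  have "prox E l f = (SOME g. is_arg_min (prox_objective E l f) (\<lambda>_. True) g)"
    using l by (simp add: prox_def arg_min_def)
  then show ?thesis
    using ex1_is_arg_min_prox[OF l, of f] unfolding is_arg_min_prox_iff_subdifferential[OF l, symmetric]
    by (metis (mono_tags, lifting) someI)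
qed

lemma prox_subdifferential:
  "l > 0 \<Longrightarrow> (prox E l f, (1 / l) *\<^sub>R (f - prox E l f)) \<in> subdifferential E"
  using prox_eq_iff by blast

lemma prox_add_subdifferential:
  "l > 0 \<Longrightarrow> (g, v) \<in> subdifferential E \<Longrightarrow> prox E l (g + l *\<^sub>R v) = g"
  by (simp add: prox_eq_iff)

lemma prox_in_D: "l > 0 \<Longrightarrow> prox E l f \<in> D"
  using prox_subdifferential by (auto simp: subdifferential_iff)

text \<open>The inverse relation on the right of \<open>generated_by\<close> is itself the graph of
  \<open>prox E l\<close>, so equality of graphs reduces to equality of functions.\<close>

lemma generated_by_subdifferential_iff:
  "generated_by J (subdifferential E) \<longleftrightarrow> (\<forall>l>0. J l = prox E l)"
proof -
  have "{(f, J l f) |f. True} = {(g, g + l *\<^sub>R v) |g v. (g, v) \<in> subdifferential E}\<inverse>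
      \<longleftrightarrow> J l = prox E l" if l: "l > 0" for l
  proof -
    have "{(g, g + l *\<^sub>R v) |g v. (g, v) \<in> subdifferential E}\<inverse> = {(f, prox E l f) |f. True}"
    proof (intro equalityI subsetI)
      fix p assume "p \<in> {(g, g + l *\<^sub>R v) |g v. (g, v) \<in> subdifferential E}\<inverse>"
      then show "p \<in> {(f, prox E l f) |f. True}"
        using prox_add_subdifferential[OF l] by force
    next
      fix p assume "p \<in> {(f, prox E l f) |f. True}"
      then obtain f where p: "p = (f, prox E l f)" by blast
      have "f = prox E l f + l *\<^sub>R ((1 / l) *\<^sub>R (f - prox E l f))" using l by simp
      then show "p \<in> {(g, g + l *\<^sub>R v) |g v. (g, v) \<in> subdifferential E}\<inverse>"
        using prox_subdifferential[OF l, of f] p by blast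
    qed
    then show ?thesis by (auto simp: set_eq_iff fun_eq_iff)
  qed
  then show ?thesis by (auto simp: generated_by_def)
qed

text \<open>Monotonicity yields the firm inequality
  \<open>?p \<bullet> ?p \<le> (f - g) \<bullet> ?p\<close>; Cauchy-Schwarz does the rest.\<close>

lemma prox_nonexpansive:
  assumes l: "l > 0"
  shows "norm (prox E l f - prox E l g) \<le> norm (f - g)"
proof -
  let ?p = "prox E l f - prox E l g"
  have "(1 / l) *\<^sub>R (f - prox E l f) - (1 / l) *\<^sub>R (g - prox E l g) = (1 / l) *\<^sub>R ((f - g) - ?p)"
    by (simp add: algebra_simps)
  then have "0 \<le> (1 / l) * (((f - g) - ?p) \<bullet> ?p)"
    using subdifferential_monotone[OF prox_subdifferential[OF l, of f] prox_subdifferential[OF l, of g]]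
    by simp
  then have "?p \<bullet> ?p \<le> (f - g) \<bullet> ?p"
    using l by (simp add: inner_diff_left zero_le_divide_iff)
  then have "norm ?p * norm ?p \<le> norm (f - g) * norm ?p"
    using norm_cauchy_schwarz[of "f - g" ?p] by (simp flip: power2_norm_eq_inner power2_eq_square)
  then show ?thesis by (cases "?p = 0") auto
qed

text \<open>The Moreau envelope \<open>\<lambda>f. inf\<^sub>g (\<parallel>f - g\<parallel>\<^sup>2 / (2 l) + E g)\<close>, evaluated at its minimiser.\<close>

definition moreau :: "real \<Rightarrow> 'a \<Rightarrow> real" where
  "moreau l f = 1 / (2 * l) * (norm (f - prox E l f))\<^sup>2 + e (prox E l f)"

lemma moreau_le:
  assumes "l > 0" "h \<in> D"
  shows "moreau l f \<le> 1 / (2 * l) * (norm (f - h))\<^sup>2 + e h"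
proof -
  have "is_arg_min (prox_objective E l f) (\<lambda>_. True) (prox E l f)"
    using assms prox_subdifferential by (simp add: is_arg_min_prox_iff_subdifferential)
  then show ?thesis using assms by (simp add: is_arg_min_prox_iff moreau_def)
qed

text \<open>The approximant is a subgradient of the Moreau envelope: add the subgradient inequality
  of \<open>E\<close> between the two proximal points to
  \<open>(a - b) \<bullet> (a - b) \<ge> 0\<close>.\<close>

lemma moreau_subgradient:
  assumes l: "l > 0"
  shows "approximant (prox E) l f \<bullet> (h - f) \<le> moreau l h - moreau l f"
proof -
  define a b where "a = approximant (prox E) l h" and "b = approximant (prox E) l f"
  have eqs: "h = prox E l h + l *\<^sub>R a" "f = prox E l f + l *\<^sub>R b"
    using l by (simp_all add: a_def b_def approximant_def)
  have na: "1 / (2 * l) * (norm (h - prox E l h))\<^sup>2 = l / 2 * (a \<bullet> a)"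
    and nb: "1 / (2 * l) * (norm (f - prox E l f))\<^sup>2 = l / 2 * (b \<bullet> b)"
    using l by (simp_all add: a_def b_def approximant_def power2_norm_eq_inner)
  have sub: "b \<bullet> (prox E l h - prox E l f) \<le> e (prox E l h) - e (prox E l f)"
    using prox_subdifferential[OF l, of f] prox_in_D[OF l, of h]
    by (simp add: subdifferential_iff b_def approximant_def)
  have "h - f = (prox E l h - prox E l f) + l *\<^sub>R (a - b)"
    by (subst (1) eqs(1), subst (1) eqs(2)) (simp add: algebra_simps)
  then have "b \<bullet> (h - f) = b \<bullet> (prox E l h - prox E l f) + l * (a \<bullet> b - b \<bullet> b)"
    by (simp add: inner_right_distrib inner_diff_right inner_commute)
  moreover have "0 \<le> l / 2 * ((a - b) \<bullet> (a - b))" using l by simp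
  then have "l * (a \<bullet> b - b \<bullet> b) \<le> l / 2 * (a \<bullet> a) - l / 2 * (b \<bullet> b)"
    by (simp add: inner_diff inner_commute algebra_simps)
  ultimately show ?thesis
    unfolding moreau_def na nb b_def[symmetric] using sub by linarith
qed

end

section \<open>Metric projections onto closed convex sets\<close>

text \<open>The obtuse-angle condition gives a Pythagorean inequality, so the distance grows
  strictly away from \<open>p\<close>. Minimisers are characterised completely because
  \<open>metric_proj\<close> rests on choice.\<close>

lemma is_arg_min_dist_unique:
  fixes f p :: "'a::real_inner"
  assumes p: "p \<in> K" "\<And>k. k \<in> K \<Longrightarrow> (f - p) \<bullet> (k - p) \<le> 0"
  shows "is_arg_min (dist f) (\<lambda>x. x \<in> K) q \<longleftrightarrow> q = p"
proof -
  have le: "(dist f p)\<^sup>2 + (norm (k - p))\<^sup>2 \<le> (dist f k)\<^sup>2" if "k \<in> K" for k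
  proof -
    have "(dist f k)\<^sup>2 = (dist f p)\<^sup>2 - 2 * ((f - p) \<bullet> (k - p)) + (norm (k - p))\<^sup>2"
      by (simp add: dist_norm power2_norm_eq_inner inner_diff_left inner_diff_right
          inner_commute algebra_simps)
    then show ?thesis using p(2)[OF that] by linarith
  qed
  have le': "dist f p \<le> dist f k" if "k \<in> K" for k
  proof (rule power2_le_imp_le)
    show "(dist f p)\<^sup>2 \<le> (dist f k)\<^sup>2" using le[OF that] zero_le_power2[of "norm (k - p)"] by linarith
  qed simp
  show ?thesis
  proof
    assume "is_arg_min (dist f) (\<lambda>x. x \<in> K) q"
    then have q: "q \<in> K" "dist f q \<le> dist f p" using p(1) by (auto simp: is_arg_min_def not_less)
    then have "(dist f q)\<^sup>2 \<le> (dist f p)\<^sup>2" by (intro power_mono) auto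
    with le[OF q(1)] have "(norm (q - p))\<^sup>2 \<le> 0" by linarith
    then show "q = p" by simp
  next
    assume "q = p"
    then show "is_arg_min (dist f) (\<lambda>x. x \<in> K) q"
      using p(1) le' by (auto simp: is_arg_min_def not_less)
  qed
qed

lemma metric_proj_eqI:
  fixes f p :: "'a::real_inner"
  assumes "p \<in> K" "\<And>k. k \<in> K \<Longrightarrow> (f - p) \<bullet> (k - p) \<le> 0"
  shows "metric_proj K f = p"
  using is_arg_min_dist_unique[OF assms]
  by (simp add: metric_proj_def arg_min_on_def arg_min_def)

lemma metric_proj_self: "f \<in> K \<Longrightarrow> metric_proj K f = f" for f :: "'a::real_inner"
  by (rule metric_proj_eqI) auto

lemma convex_lsc_convex_indicator:
  fixes K :: "'a::{real_inner, complete_space} set"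
  assumes K: "K \<noteq> {}" "closed K" "convex K"
  shows "convex_lsc (\<lambda>x. if x \<in> K then 0 else \<infinity>)" (is "convex_lsc ?I")
proof
  show ninf: "?I f \<noteq> -\<infinity>" for f by simp
  show "convex_functional ?I"
    by (rule convex_functionalI) (use K(3) in \<open>auto split: if_splits simp: convex_alt zero_ereal_def\<close>)
  show "proper_functional ?I" using K(1) by (auto simp: proper_functional_def eff_domain_def)
  show "lsc_functional ?I"
    unfolding lsc_functional_iff
  proof (intro allI impI)
    fix f y assume y: "y < ?I f"
    show "eventually (\<lambda>x. y < ?I x) (nhds f)"
    proof (cases "f \<in> K")
      case True
      with y have "y < 0" by simp
      then have "y < ?I x" for x by (auto intro: less_trans)
      then show ?thesis by simp
    next
      case False
      then have "eventually (\<lambda>x. x \<in> - K) (nhds f)"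
        using K(2) by (intro eventually_nhds_in_open) auto
      then show ?thesis by eventually_elim (use y False in auto)
    qed
  qed
qed

text \<open>The projection is the proximal map of the indicator functional.\<close>

lemma metric_proj_props:
  fixes K :: "'a::{real_inner, complete_space} set"
  assumes K: "K \<noteq> {}" "closed K" "convex K"
  shows metric_proj_in: "metric_proj K f \<in> K"
    and metric_proj_obtuse: "k \<in> K \<Longrightarrow> (f - metric_proj K f) \<bullet> (k - metric_proj K f) \<le> 0"
proof -
  let ?I = "\<lambda>x. if x \<in> K then 0 else \<infinity> :: ereal"
  interpret I: convex_lsc ?I using convex_lsc_convex_indicator[OF K] .
  have D: "eff_domain ?I = K" by (auto simp: eff_domain_def)
  have p: "prox ?I 1 f \<in> K" "\<And>k. k \<in> K \<Longrightarrow> (f - prox ?I 1 f) \<bullet> (k - prox ?I 1 f) \<le> 0"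
    using I.prox_subdifferential[of 1 f] by (auto simp: I.subdifferential_iff D)
  have eq: "metric_proj K f = prox ?I 1 f" by (rule metric_proj_eqI[OF p])
  show "metric_proj K f \<in> K" "k \<in> K \<Longrightarrow> (f - metric_proj K f) \<bullet> (k - metric_proj K f) \<le> 0"
    using p by (simp_all add: eq)
qed

text \<open>Adding the obtuse-angle inequalities for \<open>f\<close> and \<open>g\<close> gives the
  same firm inequality as for proximal points.\<close>

lemma metric_proj_nonexpansive:
  fixes K :: "'a::{real_inner, complete_space} set"
  assumes K: "K \<noteq> {}" "closed K" "convex K"
  shows "norm (metric_proj K f - metric_proj K g) \<le> norm (f - g)"
proof -
  let ?p = "metric_proj K f - metric_proj K g"
  have "(f - metric_proj K f) \<bullet> (metric_proj K g - metric_proj K f) \<le> 0"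
    "(g - metric_proj K g) \<bullet> (metric_proj K f - metric_proj K g) \<le> 0"
    using metric_proj_props[OF K] by blast+
  then have "?p \<bullet> ?p \<le> (f - g) \<bullet> ?p"
    by (simp add: inner_diff_left inner_diff_right)
  then have "norm ?p * norm ?p \<le> norm (f - g) * norm ?p"
    using norm_cauchy_schwarz[of "f - g" ?p] by (simp flip: power2_norm_eq_inner power2_eq_square)
  then show ?thesis by (cases "?p = 0") auto
qed

text \<open>The increments of \<phi> telescope to 0 around a cycle, and each is at most the
  corresponding inner product.\<close>

lemma subgradient_cyclically_monotone:
  assumes sub: "\<And>f h. B f \<bullet> (h - f) \<le> \<phi> h - \<phi> f"
  shows "cyclically_monotone B"
  unfolding cyclically_monotone_def
proof (intro allI impI)
  fix n and f :: "nat \<Rightarrow> 'a" assume "f 0 = f n"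
  then have "0 = (\<Sum>i=1..n. \<phi> (f i) - \<phi> (f (i - 1)))"
    using sum_telescope''[of 0 n "\<lambda>i. \<phi> (f i)"] by simp
  also have "\<dots> \<le> (\<Sum>i=1..n. (f i - f (i - 1)) \<bullet> B (f i))"
  proof (rule sum_mono)
    fix i show "\<phi> (f i) - \<phi> (f (i - 1)) \<le> (f i - f (i - 1)) \<bullet> B (f i)"
      using sub[of "f i" "f (i - 1)"] by (simp add: inner_diff inner_commute)
  qed
  finally show "0 \<le> (\<Sum>i=1..n. (f i - f (i - 1)) \<bullet> B (f i))" .
qed

section \<open>The proximal maps as a resolvent, and their limits as the parameter tends to
  0\<close>

context convex_lsc
begin

lemma closure_D: "closure D \<noteq> {}" "closed (closure D)" "convex (closure D)"
  using D_nonempty convex_D by (auto intro: convex_closure)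

lemma prox_cyclically_monotone:
  assumes l: "l > 0"
  shows "cyclically_monotone (\<lambda>f. f - prox E l f)"
proof (rule subgradient_cyclically_monotone)
  fix f h
  have "l * (approximant (prox E) l f \<bullet> (h - f)) \<le> l * (moreau l h - moreau l f)"
    using moreau_subgradient[OF l] l by (intro mult_left_mono) auto
  then show "(f - prox E l f) \<bullet> (h - f) \<le> l * moreau l h - l * moreau l f"
    using l by (simp add: approximant_def right_diff_distrib)
qed

text \<open>Minimality is tested against \<open>u\<close>, and the obtuse angle at the projection
  turns the resulting bound on \<open>norm (f - prox E l f)\<close> into one on the distance to the
  projection. The constant \<open>c\<close> does not depend on \<open>l\<close>.\<close>

lemma prox_dist_proj_bound:
  assumes u: "u \<in> D"
  shows "\<exists>c. \<forall>l. 0 < l \<and> l < 1 \<longrightarrow> (norm (prox E l f - metric_proj (closure D) f))\<^sup>2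
      \<le> ((norm (f - u))\<^sup>2 + l * c) / (1 - l) - (norm (f - metric_proj (closure D) f))\<^sup>2"
proof -
  obtain a b where ab: "b \<ge> 0" "\<And>g. g \<in> D \<Longrightarrow> e g \<ge> - a - b * norm (f - g)"
    using linear_growth[of f] by blast
  let ?P = "metric_proj (closure D) f"
  show ?thesis
  proof (intro exI[of _ "2 * (e u + a) + b\<^sup>2"] allI impI)
    fix l :: real assume "0 < l \<and> l < 1"
    then have l: "0 < l" "l < 1" by auto
    define g where "g = prox E l f"
    define x where "x = norm (f - g)"
    have g: "g \<in> D" using prox_in_D l by (simp add: g_def)
    have "1 / (2 * l) * x\<^sup>2 + e g \<le> 1 / (2 * l) * (norm (f - u))\<^sup>2 + e u"
      using moreau_le[OF l(1) u, of f] by (simp add: moreau_def g_def x_def)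
    then have "1 / (2 * l) * x\<^sup>2 \<le> 1 / (2 * l) * (norm (f - u))\<^sup>2 + (e u + a + b * x)"
      using ab(2)[OF g] by (simp add: x_def)
    then have "2 * l * (1 / (2 * l) * x\<^sup>2) \<le> 2 * l * (1 / (2 * l) * (norm (f - u))\<^sup>2 + (e u + a + b * x))"
      using l by (intro mult_left_mono) auto
    then have 1: "x\<^sup>2 \<le> (norm (f - u))\<^sup>2 + 2 * l * (e u + a + b * x)"
      using l by (simp add: distrib_left)
    \<comment> \<open>Bounds the mixed term \<open>2 * l * b * x\<close> by
      \<open>l * x\<^sup>2 + l * b\<^sup>2\<close>; moving \<open>l * x\<^sup>2\<close> to the left
      produces the factor \<open>1 - l\<close>.\<close>
    have "0 \<le> l * (x - b)\<^sup>2" using l by simp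
    with 1 have "(1 - l) * x\<^sup>2 \<le> (norm (f - u))\<^sup>2 + l * (2 * (e u + a) + b\<^sup>2)"
      by (simp add: algebra_simps power2_eq_square)
    then have 2: "x\<^sup>2 \<le> ((norm (f - u))\<^sup>2 + l * (2 * (e u + a) + b\<^sup>2)) / (1 - l)"
      using l by (simp add: pos_le_divide_eq mult.commute)
    have "g \<in> closure D" using g closure_subset by blast
    then have "(f - ?P) \<bullet> (g - ?P) \<le> 0" by (rule metric_proj_obtuse[OF closure_D])
    moreover have "x\<^sup>2 = (norm (f - ?P))\<^sup>2 - 2 * ((f - ?P) \<bullet> (g - ?P)) + (norm (g - ?P))\<^sup>2"
      by (simp add: x_def power2_norm_eq_inner inner_diff_left inner_diff_right
          inner_commute algebra_simps)
    ultimately show "(norm (prox E l f - ?P))\<^sup>2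
        \<le> ((norm (f - u))\<^sup>2 + l * (2 * (e u + a) + b\<^sup>2)) / (1 - l) - (norm (f - ?P))\<^sup>2"
      using 2 by (simp add: g_def)
  qed
qed

lemma prox_tendsto_proj: "((\<lambda>l. prox E l f) \<longlongrightarrow> metric_proj (closure D) f) (at_right 0)"
proof (rule tendstoI)
  let ?P = "metric_proj (closure D) f"
  fix \<epsilon> :: real assume \<epsilon>: "\<epsilon> > 0"
  \<comment> \<open>\<open>E\<close> may be infinite at the projection, so a nearby point of
    \<open>D\<close> is the competitor. It is fixed first, and only then does \<open>l\<close> tend
    to 0.\<close>
  obtain u where u: "\<And>n. u n \<in> D" "u \<longlonglongrightarrow> ?P"
    using metric_proj_in[OF closure_D, of f] by (auto simp: closure_sequential)
  have "(\<lambda>n. (norm (f - u n))\<^sup>2) \<longlonglongrightarrow> (norm (f - ?P))\<^sup>2" by (intro tendsto_intros u)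
  then have "eventually (\<lambda>n. (norm (f - u n))\<^sup>2 < (norm (f - ?P))\<^sup>2 + \<epsilon>\<^sup>2) sequentially"
    by (rule order_tendstoD) (use \<epsilon> in auto)
  then obtain n where n: "(norm (f - u n))\<^sup>2 < (norm (f - ?P))\<^sup>2 + \<epsilon>\<^sup>2"
    using eventually_happens by force
  obtain c where c: "\<And>l. 0 < l \<Longrightarrow> l < 1 \<Longrightarrow> (norm (prox E l f - ?P))\<^sup>2
      \<le> ((norm (f - u n))\<^sup>2 + l * c) / (1 - l) - (norm (f - ?P))\<^sup>2"
    using prox_dist_proj_bound[OF u(1)[of n], of f] by blast
  have "((\<lambda>l. ((norm (f - u n))\<^sup>2 + l * c) / (1 - l) - (norm (f - ?P))\<^sup>2)
      \<longlongrightarrow> (norm (f - u n))\<^sup>2 - (norm (f - ?P))\<^sup>2) (at_right 0)"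
    by (auto intro!: tendsto_eq_intros)
  then have "eventually (\<lambda>l. ((norm (f - u n))\<^sup>2 + l * c) / (1 - l) - (norm (f - ?P))\<^sup>2 < \<epsilon>\<^sup>2) (at_right 0)"
    by (rule order_tendstoD) (use n in simp)
  moreover have "eventually (\<lambda>l. 0 < l \<and> l < (1::real)) (at_right 0)"
    by (auto simp: eventually_at_right_field intro!: exI[of _ 1])
  ultimately show "eventually (\<lambda>l. dist (prox E l f) ?P < \<epsilon>) (at_right 0)"
  proof eventually_elim
    case (elim l)
    then have "(norm (prox E l f - ?P))\<^sup>2 < \<epsilon>\<^sup>2" using c[of l] by simp
    then show ?case using \<epsilon> by (auto simp: dist_norm intro: power_less_imp_less_base)
  qed
qed

text \<open>For \<open>m > 0\<close> the inner argument is the point \<open>prox E l f\<close>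
  shifted by \<open>m\<close> times its own subgradient; for \<open>m = 0\<close> the projection
  fixes points of the closure.\<close>

lemma prox_resolvent_identity:
  assumes l: "l > 0" and m: "m \<ge> 0"
  shows "prox E l f = prox E m ((m / l) *\<^sub>R f + (1 - m / l) *\<^sub>R prox E l f)"
proof (cases "m = 0")
  case True
  have "prox E l f \<in> closure D" using prox_in_D[OF l] closure_subset by blast
  then show ?thesis using True by (simp add: prox_def[of _ 0] metric_proj_self)
next
  case False
  have "(m / l) *\<^sub>R f + (1 - m / l) *\<^sub>R prox E l f = prox E l f + m *\<^sub>R ((1 / l) *\<^sub>R (f - prox E l f))"
    by (simp add: algebra_simps)
  then show ?thesis
    using prox_add_subdifferential[OF _ prox_subdifferential[OF l]] m False by simp
qed

lemma prox_zero: "prox E 0 = metric_proj (closure D)"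
  by (simp add: prox_def fun_eq_iff)

lemma nonexp_resolvent_prox: "nonexp_resolvent (closure D) (prox E)"
  unfolding nonexp_resolvent_def
proof (intro conjI allI impI)
  show "((\<lambda>l. norm (prox E l f - metric_proj (closure D) f)) \<longlongrightarrow> 0) (at_right 0)" for f
    using prox_tendsto_proj[of f] tendsto_norm_zero Lim_null by blast
  show "norm (prox E l f - prox E l g) \<le> norm (f - g)" if "l \<ge> 0" for l f g
    using that prox_nonexpansive[of l f g] metric_proj_nonexpansive[OF closure_D, of f g]
    by (cases "l = 0") (auto simp: prox_zero)
  show "prox E l = prox E m \<circ> (\<lambda>f. (m / l) *\<^sub>R f + (1 - m / l) *\<^sub>R prox E l f)" if "l > 0" "m \<ge> 0" for l m
    using prox_resolvent_identity[OF that] by (auto simp: fun_eq_iff)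
qed (use closure_D in \<open>simp_all add: prox_zero\<close>)

text \<open>The envelope lies between \<open>E (prox E l f)\<close> and \<open>E f\<close>, and
  lower semicontinuity along \<open>prox E l f\<close> closes the gap. This includes points of the
  closure where \<open>E f = \<infinity>\<close>.\<close>

lemma moreau_tendsto:
  assumes f: "f \<in> closure D"
  shows "((\<lambda>l. ereal (moreau l f)) \<longlongrightarrow> E f) (at_right 0)"
proof (rule order_tendstoI)
  have pos: "eventually (\<lambda>l. 0 < (l::real)) (at_right 0)" by (simp add: eventually_at_right_less)
  fix y assume "y < E f"
  then have "eventually (\<lambda>x. y < E x) (nhds f)" using lscE by (simp add: lsc_functional_iff)
  moreover have "((\<lambda>l. prox E l f) \<longlongrightarrow> f) (at_right 0)"
    using prox_tendsto_proj[of f] metric_proj_self[OF f] by simp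
  ultimately have "eventually (\<lambda>l. y < E (prox E l f)) (at_right 0)"
    by (rule eventually_compose_filterlim)
  then show "eventually (\<lambda>l. y < ereal (moreau l f)) (at_right 0)"
    using pos
  proof eventually_elim
    case (elim l)
    then have "E (prox E l f) \<le> ereal (moreau l f)"
      by (subst E_eq) (auto simp: moreau_def prox_in_D)
    with elim show ?case by (meson less_le_trans)
  qed
next
  have pos: "eventually (\<lambda>l. 0 < (l::real)) (at_right 0)" by (simp add: eventually_at_right_less)
  fix y assume y: "E f < y"
  then have fD: "f \<in> D" by (auto simp: eff_domain_def)
  show "eventually (\<lambda>l. ereal (moreau l f) < y) (at_right 0)"
    using pos
  proof eventually_elim
    case (elim l)
    have "ereal (moreau l f) \<le> E f"
      by (subst E_eq[OF fD]) (use moreau_le[OF elim fD, of f] in simp)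
    with y show ?case by (meson le_less_trans)
  qed
qed

text \<open>The bound forces \<open>prox E l f\<close> to converge to \<open>f\<close>, and the
  subgradient inequality against a fixed \<open>u\<close> bounds \<open>E\<close> along the way;
  lower semicontinuity carries the bound to \<open>f\<close>.\<close>

lemma bounded_approximant_imp_D:
  assumes bd: "eventually (\<lambda>l. norm (approximant (prox E) l f) \<le> M) (at_right 0)"
  shows "f \<in> D"
proof -
  have pos: "eventually (\<lambda>l. 0 < (l::real)) (at_right 0)" by (simp add: eventually_at_right_less)
  obtain u where u: "u \<in> D" using D_nonempty by blast
  have "eventually (\<lambda>l. norm (prox E l f - f) \<le> l * M) (at_right 0)"
    using bd pos
  proof eventually_elim
    case (elim l)
    then have "norm (f - prox E l f) \<le> l * M" by (simp add: approximant_def pos_divide_le_eq mult.commute del: scaleR_right_diff_distrib)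
    then show ?case by (simp add: norm_minus_commute)
  qed
  moreover have "((\<lambda>l. l * M) \<longlongrightarrow> 0) (at_right 0)" by (auto intro!: tendsto_eq_intros)
  ultimately have "((\<lambda>l. prox E l f - f) \<longlongrightarrow> 0) (at_right 0)"
    by (rule Lim_null_comparison)
  then have lim: "((\<lambda>l. prox E l f) \<longlongrightarrow> f) (at_right 0)" using Lim_null by blast
  have "((\<lambda>l. ereal (e u + M * norm (u - prox E l f))) \<longlongrightarrow> ereal (e u + M * norm (u - f))) (at_right 0)"
    unfolding lim_ereal by (intro tendsto_intros lim)
  moreover have "eventually (\<lambda>l. E (prox E l f) \<le> ereal (e u + M * norm (u - prox E l f))) (at_right 0)"
    using bd pos
  proof eventually_elim
    case (elim l)
    have "approximant (prox E) l f \<bullet> (u - prox E l f) \<le> e u - e (prox E l f)"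
      using prox_subdifferential[OF elim(2), of f] u by (simp add: subdifferential_iff approximant_def)
    moreover have "\<bar>approximant (prox E) l f \<bullet> (u - prox E l f)\<bar> \<le> M * norm (u - prox E l f)"
      using Cauchy_Schwarz_ineq2 elim(1) by (meson mult_right_mono norm_ge_zero order_trans)
    ultimately show ?case
      by (subst E_eq[OF prox_in_D[OF elim(2)]]) simp
  qed
  ultimately have "E f \<le> ereal (e u + M * norm (u - f))"
    using lsc_functional_le_lim[OF lscE lim] by simp
  then show ?thesis using D_iff by blast
qed

text \<open>The limit of the cyclical envelopes is normalised at \<open>f0\<close>, hence differs
  from the reconstructed functional by a constant.\<close>

lemma add_const:
  shows "convex_lsc (\<lambda>f. E f + ereal c)"
    and "eff_domain (\<lambda>f. E f + ereal c) = D"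
    and "subdifferential (\<lambda>f. E f + ereal c) = subdifferential E"
proof -
  show D: "eff_domain (\<lambda>f. E f + ereal c) = D" by (auto simp: eff_domain_def)
  have "(E g + ereal c) - (E f + ereal c) = E g - E f" if "f \<in> D" "g \<in> D" for f g
    by (subst (1 2 3 4) E_eq) (use that in auto)
  then show "subdifferential (\<lambda>f. E f + ereal c) = subdifferential E"
    unfolding subdifferential_def D by auto
  show "convex_lsc (\<lambda>f. E f + ereal c)"
  proof
    show ninf: "E f + ereal c \<noteq> -\<infinity>" for f using not_minf[of f] by auto
    show "convex_functional (\<lambda>f. E f + ereal c)"
    proof (rule convex_functionalI[OF ninf])
      fix f g a b and t :: real
      assume *: "E f + ereal c = ereal a" "E g + ereal c = ereal b" and t: "0 < t" "t < 1"
      have fg: "f \<in> D" "g \<in> D" using * by (auto simp: eff_domain_def)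
      have ab: "a = e f + c" "b = e g + c" using * E_eq[OF fg(1)] E_eq[OF fg(2)]
        by (metis plus_ereal.simps(1) ereal.inject)+
      show "E ((1 - t) *\<^sub>R f + t *\<^sub>R g) + ereal c \<le> ereal ((1 - t) * a + t * b)"
        using convexD[OF fg, of t] t by (subst E_eq) (auto simp: ab algebra_simps)
    qed
    show "proper_functional (\<lambda>f. E f + ereal c)" using D D_nonempty by (simp add: proper_functional_def)
    show "lsc_functional (\<lambda>f. E f + ereal c)"
      unfolding lsc_functional_iff
    proof (intro allI impI)
      fix f y assume "y < E f + ereal c"
      then have "y - ereal c < E f" by (simp add: ereal_minus_less)
      then have "eventually (\<lambda>x. y - ereal c < E x) (nhds f)"
        using lscE by (simp add: lsc_functional_iff)
      then show "eventually (\<lambda>x. y < E x + ereal c) (nhds f)"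
        by eventually_elim (simp add: ereal_minus_less)
    qed
  qed
qed

end

section \<open>Cyclical envelopes of Lipschitz gradients\<close>

text \<open>The upper bound is telescoping of the subgradient inequality; the lower bound uses
  equidistant chains on the segment from \<open>f0\<close> to \<open>f\<close>, whose error is of order \<open>1/n\<close> by the
  Lipschitz condition.\<close>

lemma cyclical_envelope_eq_potential:
  fixes B :: "'a::real_inner \<Rightarrow> 'a"
  assumes sub: "\<And>f h. B f \<bullet> (h - f) \<le> \<phi> h - \<phi> f"
    and lip: "\<And>f h. norm (B f - B h) \<le> L * norm (f - h)"
  shows "cyclical_envelope B f0 f = ereal (\<phi> f - \<phi> f0)"
proof (rule antisym)
  show "cyclical_envelope B f0 f \<le> ereal (\<phi> f - \<phi> f0)"
    unfolding cyclical_envelope_def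
  proof (rule SUP_least, clarify)
    fix n and h :: "nat \<Rightarrow> 'a"
    have "(\<Sum>i=0..n. (h (Suc i) - h i) \<bullet> B (h i)) \<le> (\<Sum>i=0..n. \<phi> (h (Suc i)) - \<phi> (h i))"
      by (rule sum_mono) (use sub in \<open>simp add: inner_commute\<close>)
    also have "\<dots> = \<phi> (h (Suc n)) - \<phi> (h 0)" by (subst sum_Suc_diff) auto
    finally show "ereal (\<Sum>i=0..n. (h (Suc i) - h i) \<bullet> B (h i)) \<le> ereal (\<phi> (h (Suc n)) - \<phi> (h 0))"
      by simp
  qed
next
  have ge: "ereal (\<phi> f - \<phi> f0 - L * (norm (f - f0))\<^sup>2 * (1 / real (Suc n))) \<le> cyclical_envelope B f0 f" for n
  proof -
    define h where "h i = f0 + (real i / real (Suc n)) *\<^sub>R (f - f0)" for i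
    have h: "h 0 = f0" "h (Suc n) = f" by (simp_all add: h_def)
    have step: "h (Suc i) - h i = (1 / real (Suc n)) *\<^sub>R (f - f0)" for i
      by (simp add: h_def add_divide_distrib flip: scaleR_diff_left)
    define \<delta> where "\<delta> = norm (f - f0) / real (Suc n)"
    have nstep: "norm (h (Suc i) - h i) = \<delta>" for i by (simp add: step \<delta>_def)
    \<comment> \<open>An upper bound on the increment of \<phi> needs \<open>B\<close> at the right
      end of the step, whereas the envelope has it at the left end; the Lipschitz condition makes
      the exchange at cost \<open>L * \<delta>\<^sup>2\<close>.\<close>
    have "\<phi> (h (Suc i)) - \<phi> (h i) - L * \<delta>\<^sup>2 \<le> (h (Suc i) - h i) \<bullet> B (h i)" for i
    proof -
      have "(h (Suc i) - h i) \<bullet> (B (h (Suc i)) - B (h i)) \<le> \<delta> * (L * \<delta>)"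
        using norm_cauchy_schwarz[of "h (Suc i) - h i" "B (h (Suc i)) - B (h i)"]
          mult_left_mono[OF lip[of "h (Suc i)" "h i"], of \<delta>] nstep[of i] norm_ge_zero
        by (metis order_trans)
      moreover have "B (h (Suc i)) \<bullet> (h i - h (Suc i)) \<le> \<phi> (h i) - \<phi> (h (Suc i))" by (rule sub)
      ultimately show ?thesis
        by (simp add: inner_diff_left inner_diff_right inner_commute power2_eq_square algebra_simps)
    qed
    then have "(\<Sum>i=0..n. \<phi> (h (Suc i)) - \<phi> (h i) - L * \<delta>\<^sup>2) \<le> (\<Sum>i=0..n. (h (Suc i) - h i) \<bullet> B (h i))"
      by (intro sum_mono) auto
    moreover have "(\<Sum>i=0..n. \<phi> (h (Suc i)) - \<phi> (h i) - L * \<delta>\<^sup>2) = \<phi> f - \<phi> f0 - real (Suc n) * (L * \<delta>\<^sup>2)"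
      unfolding sum_subtractf[of _ "\<lambda>_. L * \<delta>\<^sup>2"] by (subst sum_Suc_diff) (auto simp: h)
    moreover have "real (Suc n) * (L * \<delta>\<^sup>2) = L * (norm (f - f0))\<^sup>2 * (1 / real (Suc n))"
      by (simp add: \<delta>_def power2_eq_square del: of_nat_Suc)
    ultimately have "ereal (\<phi> f - \<phi> f0 - L * (norm (f - f0))\<^sup>2 * (1 / real (Suc n)))
        \<le> ereal (\<Sum>i=0..n. (h (Suc i) - h i) \<bullet> B (h i))" by simp
    also have "\<dots> \<le> cyclical_envelope B f0 f"
      unfolding cyclical_envelope_def by (rule SUP_upper2[of "(n, h)"]) (auto simp: h)
    finally show ?thesis .
  qed
  have "(\<lambda>n. 1 / real (Suc n)) \<longlonglongrightarrow> 0"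
    using LIMSEQ_inverse_real_of_nat by (simp add: inverse_eq_divide)
  then have "(\<lambda>n. \<phi> f - \<phi> f0 - L * (norm (f - f0))\<^sup>2 * (1 / real (Suc n)))
      \<longlonglongrightarrow> \<phi> f - \<phi> f0 - L * (norm (f - f0))\<^sup>2 * 0"
    by (intro tendsto_intros)
  then have "(\<lambda>n. ereal (\<phi> f - \<phi> f0 - L * (norm (f - f0))\<^sup>2 * (1 / real (Suc n))))
      \<longlonglongrightarrow> ereal (\<phi> f - \<phi> f0)" by simp
  then show "ereal (\<phi> f - \<phi> f0) \<le> cyclical_envelope B f0 f"
    by (rule tendsto_upperbound) (use ge in auto)
qed

section \<open>Cyclically monotone graphs and Rockafellar's potential\<close>

text \<open>The definition evaluates \<open>B\<close> at the end of each increment, Rockafellar's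
  sums at its start. Traversing the cycle backwards converts one into the other.\<close>

lemma cyclically_monotone_forward:
  assumes "cyclically_monotone B"
  shows "(\<Sum>i<n. (f (Suc i) - f i) \<bullet> B (f i)) + (f 0 - f n) \<bullet> B (f n) \<le> 0"
proof -
  \<comment> \<open>The reversed chain runs from \<open>F 1 = f n\<close> to
    \<open>F (Suc n) = f 0\<close>; index 0 is set to \<open>f 0\<close> to close the cycle.\<close>
  define F where "F j = (if j = 0 then f 0 else f (Suc n - j))" for j
  have "0 \<le> (\<Sum>i=1..Suc n. (F i - F (i - 1)) \<bullet> B (F i))"
    using assms[unfolded cyclically_monotone_def, rule_format, of F "Suc n"] by (simp add: F_def)
  also have "\<dots> = (\<Sum>i<Suc n. (F (Suc i) - F i) \<bullet> B (F (Suc i)))"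
    by (simp add: sum.atLeast1_atMost_eq)
  also have "\<dots> = (f n - f 0) \<bullet> B (f n) + (\<Sum>i<n. (f (n - Suc i) - f (n - i)) \<bullet> B (f (n - Suc i)))"
    by (subst sum.lessThan_Suc_shift) (simp add: F_def)
  also have "(\<Sum>i<n. (f (n - Suc i) - f (n - i)) \<bullet> B (f (n - Suc i)))
      = (\<Sum>i<n. (f (n - Suc i) - f (Suc (n - Suc i))) \<bullet> B (f (n - Suc i)))"
    by (intro sum.cong) (auto simp: Suc_diff_Suc)
  also have "\<dots> = (\<Sum>i<n. (f i - f (Suc i)) \<bullet> B (f i))"
    by (rule sum.nat_diff_reindex)
  also have "\<dots> = - (\<Sum>i<n. (f (Suc i) - f i) \<bullet> B (f i))"
    by (simp add: inner_diff_left flip: sum_negf)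
  finally show ?thesis by (simp add: inner_diff_left)
qed

text \<open>The closing edge from \<open>h n\<close> back to \<open>h 0\<close> is kept apart so
  that the expression is literally a term of Rockafellar's supremum evaluated at
  \<open>h 0\<close>.\<close>

definition graph_cyclically_monotone :: "('a::real_inner \<times> 'a) set \<Rightarrow> bool" where
  "graph_cyclically_monotone A \<longleftrightarrow>
     (\<forall>n h v. (\<forall>i\<le>n. (h i, v i) \<in> A) \<longrightarrow>
        (\<Sum>i<n. (h (Suc i) - h i) \<bullet> v i) + (h 0 - h n) \<bullet> v n \<le> 0)"

text \<open>Letting \<open>l \<rightarrow> 0\<close> in the cyclic inequality for \<open>I - J l\<close> at the points \<open>h i + l v i\<close>.\<close>

lemma graph_cyclically_monotoneI:
  assumes cyc: "\<And>l. l > 0 \<Longrightarrow> cyclically_monotone (\<lambda>f. f - J l f)"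
    and A: "\<And>g v l. (g, v) \<in> A \<Longrightarrow> l > 0 \<Longrightarrow> J l (g + l *\<^sub>R v) = g"
  shows "graph_cyclically_monotone A"
  unfolding graph_cyclically_monotone_def
proof (intro allI impI)
  fix n and h v :: "nat \<Rightarrow> 'a" assume hv: "\<forall>i\<le>n. (h i, v i) \<in> A"
  define S where "S = (\<Sum>i<n. (h (Suc i) - h i) \<bullet> v i) + (h 0 - h n) \<bullet> v n"
  \<comment> \<open>Collects the second-order terms caused by the shifts
    \<open>l *\<^sub>R v i\<close>; it matters only that \<open>T\<close> does not depend on
    \<open>l\<close>.\<close>
  define T where "T = (\<Sum>i<n. (v (Suc i) - v i) \<bullet> v i) + (v 0 - v n) \<bullet> v n"
  have le: "S + l * T \<le> 0" if l: "l > 0" for l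
  proof -
    define f where "f i = h i + l *\<^sub>R v i" for i
    have B: "f i - J l (f i) = l *\<^sub>R v i" if "i \<le> n" for i
      using A[of "h i" "v i" l] hv that l by (simp add: f_def)
    have "(\<Sum>i<n. (f (Suc i) - f i) \<bullet> (f i - J l (f i))) + (f 0 - f n) \<bullet> (f n - J l (f n)) \<le> 0"
      by (rule cyclically_monotone_forward[OF cyc[OF l]])
    also have "(\<Sum>i<n. (f (Suc i) - f i) \<bullet> (f i - J l (f i))) = (\<Sum>i<n. (f (Suc i) - f i) \<bullet> (l *\<^sub>R v i))"
      by (intro sum.cong) (auto simp: B)
    also have "\<dots> = l * (\<Sum>i<n. (f (Suc i) - f i) \<bullet> v i)" by (simp add: sum_distrib_left)
    also have "(\<Sum>i<n. (f (Suc i) - f i) \<bullet> v i)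
        = (\<Sum>i<n. (h (Suc i) - h i) \<bullet> v i) + l * (\<Sum>i<n. (v (Suc i) - v i) \<bullet> v i)"
      unfolding sum_distrib_left sum.distrib[symmetric]
      by (intro sum.cong) (auto simp: f_def inner_diff_left inner_add_left algebra_simps)
    also have "(f 0 - f n) \<bullet> (f n - J l (f n)) = l * ((h 0 - h n) \<bullet> v n + l * ((v 0 - v n) \<bullet> v n))"
      unfolding B[OF order_refl] by (simp add: f_def inner_diff_left inner_add_left algebra_simps)
    finally have "l * (S + l * T) \<le> 0"
      by (simp add: S_def T_def distrib_left add.assoc add.left_commute)
    then show ?thesis using l by (simp add: mult_le_0_iff)
  qed
  show "S \<le> 0"
  proof (rule tendsto_upperbound)
    show "((\<lambda>l. S + l * T) \<longlongrightarrow> S) (at_right 0)" by (auto intro!: tendsto_eq_intros)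
    show "eventually (\<lambda>l. S + l * T \<le> 0) (at_right 0)"
      using le by (auto simp: eventually_at_right_field intro!: exI[of _ 1])
  qed simp
qed

text \<open>A supremum of continuous affine functions of \<open>f\<close>. The endpoint
  \<open>f\<close> carries no vector, so it need not lie in the domain of \<open>A\<close>.\<close>

definition rockafellar_potential :: "('a::real_inner \<times> 'a) set \<Rightarrow> 'a \<Rightarrow> 'a \<Rightarrow> ereal" where
  "rockafellar_potential A g0 f =
     (SUP (n, h, v) \<in> {(n :: nat, h, v). h 0 = g0 \<and> (\<forall>i\<le>n. (h i, v i) \<in> A)}.
        ereal ((\<Sum>i<n. (h (Suc i) - h i) \<bullet> v i) + (f - h n) \<bullet> v n))"

lemma rockafellar_potential_upper:
  assumes "h 0 = g0" "\<And>i. i \<le> n \<Longrightarrow> (h i, v i) \<in> A"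
  shows "ereal ((\<Sum>i<n. (h (Suc i) - h i) \<bullet> v i) + (f - h n) \<bullet> v n) \<le> rockafellar_potential A g0 f"
  unfolding rockafellar_potential_def
  by (rule SUP_upper2[of "(n, h, v)"]) (use assms in auto)

lemma less_rockafellar_potentialE:
  assumes "y < rockafellar_potential A g0 f"
  obtains n h v where "h 0 = g0" "\<And>i. i \<le> n \<Longrightarrow> (h i, v i) \<in> A"
    "y < ereal ((\<Sum>i<n. (h (Suc i) - h i) \<bullet> v i) + (f - h n) \<bullet> v n)"
  using assms unfolding rockafellar_potential_def less_SUP_iff by auto

text \<open>Evaluated at \<open>g0\<close>, every chain closes to a cycle. This gives properness and
  later finiteness on the domain of \<open>A\<close>.\<close>

lemma rockafellar_potential_base:
  assumes "graph_cyclically_monotone A"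
  shows "rockafellar_potential A g0 g0 \<le> 0"
  unfolding rockafellar_potential_def
  by (rule SUP_least) (use assms in \<open>auto simp: graph_cyclically_monotone_def\<close>)

text \<open>Appending \<open>(g, v)\<close> to a chain evaluated at \<open>g\<close> gives a chain
  for \<open>f\<close>. Approximation from below is used since the supremum need be neither attained
  nor finite.\<close>

lemma rockafellar_potential_subgradient:
  assumes gv: "(g, v) \<in> A"
  shows "rockafellar_potential A g0 g + ereal (v \<bullet> (f - g)) \<le> rockafellar_potential A g0 f"
proof -
  have "rockafellar_potential A g0 g \<le> rockafellar_potential A g0 f - ereal (v \<bullet> (f - g))"
  proof (rule dense_le)
    fix y assume "y < rockafellar_potential A g0 g"
    then obtain n h w where h: "h 0 = g0" "\<And>i. i \<le> n \<Longrightarrow> (h i, w i) \<in> A"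
      and y: "y < ereal ((\<Sum>i<n. (h (Suc i) - h i) \<bullet> w i) + (g - h n) \<bullet> w n)"
      by (rule less_rockafellar_potentialE) blast
    define h' where "h' = h(Suc n := g)"
    define w' where "w' = w(Suc n := v)"
    have "(\<Sum>i<Suc n. (h' (Suc i) - h' i) \<bullet> w' i) = (\<Sum>i<n. (h (Suc i) - h i) \<bullet> w i) + (g - h n) \<bullet> w n"
      by (simp add: h'_def w'_def)
    moreover have "ereal ((\<Sum>i<Suc n. (h' (Suc i) - h' i) \<bullet> w' i) + (f - h' (Suc n)) \<bullet> w' (Suc n))
        \<le> rockafellar_potential A g0 f"
      by (rule rockafellar_potential_upper) (use h gv in \<open>auto simp: h'_def w'_def le_Suc_eq\<close>)
    ultimately have "ereal ((\<Sum>i<n. (h (Suc i) - h i) \<bullet> w i) + (g - h n) \<bullet> w n) + ereal (v \<bullet> (f - g))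
        \<le> rockafellar_potential A g0 f"
      by (simp add: h'_def w'_def inner_commute)
    then have "ereal ((\<Sum>i<n. (h (Suc i) - h i) \<bullet> w i) + (g - h n) \<bullet> w n)
        \<le> rockafellar_potential A g0 f - ereal (v \<bullet> (f - g))"
      by (simp add: ereal_le_minus)
    with y show "y \<le> rockafellar_potential A g0 f - ereal (v \<bullet> (f - g))" by simp
  qed
  then show ?thesis by (simp add: ereal_le_minus)
qed

text \<open>Convexity and lower semicontinuity pass from the affine terms to their supremum; the
  one-point chain \<open>(g0, v0)\<close> excludes the value -\<infinity>.\<close>

lemma convex_lsc_rockafellar_potential:
  fixes A :: "('a::{real_inner, complete_space} \<times> 'a) set"
  assumes cyc: "graph_cyclically_monotone A" and g0: "(g0, v0) \<in> A"
  shows "convex_lsc (rockafellar_potential A g0)" (is "convex_lsc ?R")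
proof
  show ninf: "?R f \<noteq> -\<infinity>" for f
    using rockafellar_potential_upper[of "\<lambda>_. g0" g0 0 "\<lambda>_. v0" A f] g0 by auto
  show "convex_functional ?R"
  proof (rule convex_functionalI[OF ninf])
    fix f g a b and t :: real
    assume ab: "?R f = ereal a" "?R g = ereal b" and t: "0 < t" "t < 1"
    show "?R ((1 - t) *\<^sub>R f + t *\<^sub>R g) \<le> ereal ((1 - t) * a + t * b)"
      unfolding rockafellar_potential_def[of A g0 "(1 - t) *\<^sub>R f + t *\<^sub>R g"]
    proof (rule SUP_least, clarify)
      fix n :: nat and h v assume hv: "g0 = h 0" "\<forall>i\<le>n. (h i, v i) \<in> A"
      define S where "S = (\<Sum>i<n. (h (Suc i) - h i) \<bullet> v i)"
      have up: "ereal (S + (x - h n) \<bullet> v n) \<le> ?R x" for x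
        unfolding S_def by (rule rockafellar_potential_upper) (use hv in auto)
      have "S + (f - h n) \<bullet> v n \<le> a" "S + (g - h n) \<bullet> v n \<le> b"
        using up[of f] up[of g] unfolding ab ereal_less_eq(3) .
      then have "(1 - t) * (S + (f - h n) \<bullet> v n) + t * (S + (g - h n) \<bullet> v n) \<le> (1 - t) * a + t * b"
        using t by (intro add_mono mult_left_mono) auto
      also have "(1 - t) * (S + (f - h n) \<bullet> v n) + t * (S + (g - h n) \<bullet> v n)
          = S + ((1 - t) *\<^sub>R f + t *\<^sub>R g - h n) \<bullet> v n"
        by (simp add: inner_diff_left inner_add_left algebra_simps)
      finally show "ereal ((\<Sum>i<n. (h (Suc i) - h i) \<bullet> v i) + ((1 - t) *\<^sub>R f + t *\<^sub>R g - h n) \<bullet> v n)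
          \<le> ereal ((1 - t) * a + t * b)" by (simp add: S_def)
    qed
  qed
  show "proper_functional ?R"
    using rockafellar_potential_base[OF cyc, of g0]
    by (auto simp: proper_functional_def eff_domain_def intro!: exI[of _ g0])
  show "lsc_functional ?R"
    unfolding lsc_functional_iff
  proof (intro allI impI)
    fix f y assume "y < ?R f"
    then obtain n h v where hv: "h 0 = g0" "\<And>i. i \<le> n \<Longrightarrow> (h i, v i) \<in> A"
      and y: "y < ereal ((\<Sum>i<n. (h (Suc i) - h i) \<bullet> v i) + (f - h n) \<bullet> v n)"
      by (rule less_rockafellar_potentialE) blast
    have "((\<lambda>x. ereal ((\<Sum>i<n. (h (Suc i) - h i) \<bullet> v i) + (x - h n) \<bullet> v n))
        \<longlongrightarrow> ereal ((\<Sum>i<n. (h (Suc i) - h i) \<bullet> v i) + (f - h n) \<bullet> v n)) (nhds f)"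
      unfolding lim_ereal by (intro tendsto_intros filterlim_ident)
    then have "eventually (\<lambda>x. y < ereal ((\<Sum>i<n. (h (Suc i) - h i) \<bullet> v i) + (x - h n) \<bullet> v n)) (nhds f)"
      using y by (rule order_tendstoD)
    then show "eventually (\<lambda>x. y < ?R x) (nhds f)"
    proof eventually_elim
      case (elim x)
      then show ?case
        using rockafellar_potential_upper[of h g0 n v A x] hv by (meson less_le_trans)
    qed
  qed
qed

lemma subset_subdifferential_rockafellar_potential:
  fixes A :: "('a::{real_inner, complete_space} \<times> 'a) set"
  assumes cyc: "graph_cyclically_monotone A" and g0: "(g0, v0) \<in> A"
  shows "A \<subseteq> subdifferential (rockafellar_potential A g0)"
proof clarify
  interpret R: convex_lsc "rockafellar_potential A g0"
    using convex_lsc_rockafellar_potential[OF assms] .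
  fix g v assume gv: "(g, v) \<in> A"
  \<comment> \<open>The subgradient inequality tested at \<open>g0\<close>, where the potential is
    at most 0, forces a finite value at \<open>g\<close>.\<close>
  have "rockafellar_potential A g0 g + ereal (v \<bullet> (g0 - g)) \<le> 0"
    using rockafellar_potential_subgradient[OF gv] rockafellar_potential_base[OF cyc] by (rule order_trans)
  then have g: "g \<in> R.D" by (auto simp: eff_domain_def)
  have "v \<bullet> (f - g) \<le> R.e f - R.e g" if f: "f \<in> R.D" for f
  proof -
    have "ereal (R.e g) + ereal (v \<bullet> (f - g)) \<le> ereal (R.e f)"
      using rockafellar_potential_subgradient[OF gv, of g0 f]
      unfolding R.E_eq[OF f, symmetric] R.E_eq[OF g, symmetric] .
    then show ?thesis by simp
  qed
  with g show "(g, v) \<in> subdifferential (rockafellar_potential A g0)"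
    by (simp add: R.subdifferential_iff)
qed

section \<open>Recovering the functional from the resolvent\<close>

lemma resolvent_eq_prox:
  fixes J :: "real \<Rightarrow> 'a::{real_inner, complete_space} \<Rightarrow> 'a"
  assumes res: "nonexp_resolvent C J" and cyc: "\<forall>l>0. cyclically_monotone (\<lambda>f. f - J l f)"
  obtains E where "convex_lsc E" "\<And>l. l > 0 \<Longrightarrow> J l = prox E l" "C = closure (eff_domain E)"
proof -
  \<comment> \<open>Requiring the equation for every \<open>l\<close> makes the graph independent of
    the parameter; the resolvent identity shows that it still contains all pairs of each
    \<open>J l\<close>.\<close>
  define A where "A = {(g, v). \<forall>l>0. J l (g + l *\<^sub>R v) = g}"
  have inA: "(J l f, (1 / l) *\<^sub>R (f - J l f)) \<in> A" if l: "l > 0" for l f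
  proof -
    have "J m (J l f + m *\<^sub>R ((1 / l) *\<^sub>R (f - J l f))) = J l f" if m: "m > 0" for m
    proof -
      have comp: "J l = J m \<circ> (\<lambda>f. (m / l) *\<^sub>R f + (1 - m / l) *\<^sub>R J l f)"
        using res l m unfolding nonexp_resolvent_def by (meson less_imp_le)
      have "J l f + m *\<^sub>R ((1 / l) *\<^sub>R (f - J l f)) = (m / l) *\<^sub>R f + (1 - m / l) *\<^sub>R J l f"
        by (simp add: algebra_simps)
      moreover have "J l f = J m ((m / l) *\<^sub>R f + (1 - m / l) *\<^sub>R J l f)"
        using fun_cong[OF comp, of f] by (simp only: comp_apply)
      ultimately show ?thesis by (simp only:)
    qed
    then show ?thesis by (simp add: A_def)
  qed
  have cycA: "graph_cyclically_monotone A"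
    by (rule graph_cyclically_monotoneI[OF cyc[rule_format]]) (auto simp: A_def)
  obtain g0 v0 where g0: "(g0, v0) \<in> A" using inA[of 1] by auto
  define E where "E = rockafellar_potential A g0"
  interpret E: convex_lsc E
    unfolding E_def by (rule convex_lsc_rockafellar_potential[OF cycA g0])
  have J: "J l = prox E l" if l: "l > 0" for l
  proof
    fix f
    \<comment> \<open>Inclusion of \<open>A\<close> in the subdifferential suffices, since a single
      such pair already determines the proximal point.\<close>
    have "(J l f, (1 / l) *\<^sub>R (f - J l f)) \<in> subdifferential E"
      using subset_subdifferential_rockafellar_potential[OF cycA g0] inA[OF l] unfolding E_def by blast
    then show "J l f = prox E l f" by (rule E.prox_eq_iff[OF l, THEN iffD2, symmetric])
  qed
  have C: "C \<noteq> {}" "closed C" "convex C" using res by (auto simp: nonexp_resolvent_def)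
  \<comment> \<open>Both projections are the limit of \<open>J l f\<close> as \<open>l\<close> tends
    to 0. A closed convex set is the fixed-point set of its projection, so the two sets agree as
    well.\<close>
  have proj: "metric_proj C f = metric_proj (closure E.D) f" for f
  proof (rule tendsto_unique)
    have "((\<lambda>l. norm (J l f - metric_proj C f)) \<longlongrightarrow> 0) (at_right 0)"
      using res by (simp add: nonexp_resolvent_def)
    then have "((\<lambda>l. J l f) \<longlongrightarrow> metric_proj C f) (at_right 0)"
      using tendsto_norm_zero_iff Lim_null by blast
    then show "((\<lambda>l. prox E l f) \<longlongrightarrow> metric_proj C f) (at_right 0)"
      by (rule Lim_transform_eventually) (auto simp: eventually_at_right_field J intro!: exI[of _ 1])
    show "((\<lambda>l. prox E l f) \<longlongrightarrow> metric_proj (closure E.D) f) (at_right 0)"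
      by (rule E.prox_tendsto_proj)
  qed simp
  have "C = closure E.D"
    using proj metric_proj_self metric_proj_in[OF C] metric_proj_in[OF E.closure_D] by (metis subsetI subset_antisym)
  with J E.convex_lsc_axioms show ?thesis by (intro that[of E]) auto
qed

text \<open>The Lipschitz constant \<open>2 / l\<close> blows up as \<open>l\<close> tends to 0,
  which is harmless because \<open>l\<close> stays fixed while the chains are refined.\<close>

lemma (in convex_lsc) cyclical_envelope_approximant_prox:
  assumes l: "l > 0"
  shows "cyclical_envelope (approximant (prox E) l) f0 f = ereal (moreau l f - moreau l f0)"
proof (rule cyclical_envelope_eq_potential[OF moreau_subgradient[OF l]])
  fix f g
  have eq: "f - prox E l f - (g - prox E l g) = (f - g) - (prox E l f - prox E l g)" by simp
  have "norm (f - prox E l f - (g - prox E l g)) \<le> 2 * norm (f - g)"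
    unfolding eq
    using norm_triangle_ineq4[of "f - g" "prox E l f - prox E l g"] prox_nonexpansive[OF l, of f g]
    by linarith
  then have "(1 / l) * norm (f - prox E l f - (g - prox E l g)) \<le> (1 / l) * (2 * norm (f - g))"
    using l by (intro mult_left_mono) auto
  then show "norm (approximant (prox E) l f - approximant (prox E) l g) \<le> (2 / l) * norm (f - g)"
    using l by (simp add: approximant_def flip: scaleR_right_diff_distrib)
qed

text \<open>The limit at \<open>f0\<close> is finite, so the sum of limits makes sense in
  \<open>ereal\<close> even when \<open>E f = \<infinity>\<close>.\<close>

lemma (in convex_lsc) cyclical_envelope_tendsto:
  assumes f: "f \<in> closure D" and f0: "f0 \<in> D"
    and J: "\<And>l. l > 0 \<Longrightarrow> J l = prox E l"
  shows "((\<lambda>l. cyclical_envelope (approximant J l) f0 f) \<longlongrightarrow> E f + ereal (- e f0)) (at_right 0)"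
proof -
  have "((\<lambda>l. ereal (moreau l f0)) \<longlongrightarrow> ereal (e f0)) (at_right 0)"
    using moreau_tendsto[of f0] E_eq[OF f0] f0 closure_subset by (metis subsetD)
  then have "((\<lambda>l. ereal (- moreau l f0)) \<longlongrightarrow> ereal (- e f0)) (at_right 0)"
    unfolding lim_ereal by (rule tendsto_minus)
  then have "((\<lambda>l. ereal (moreau l f) + ereal (- moreau l f0)) \<longlongrightarrow> E f + ereal (- e f0)) (at_right 0)"
    by (intro tendsto_add_ereal_general moreau_tendsto f) auto
  moreover have "eventually (\<lambda>l. ereal (moreau l f) + ereal (- moreau l f0)
      = cyclical_envelope (approximant J l) f0 f) (at_right 0)"
    unfolding eventually_at_right_field
  proof (intro exI[of _ 1] conjI allI impI)
    fix l :: real assume l: "0 < l"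
    have "approximant J l = approximant (prox E) l" using J[OF l] by (simp add: approximant_def fun_eq_iff)
    then show "ereal (moreau l f) + ereal (- moreau l f0) = cyclical_envelope (approximant J l) f0 f"
      by (simp add: cyclical_envelope_approximant_prox[OF l])
  qed simp
  ultimately show ?thesis by (rule Lim_transform_eventually)
qed

text \<open>The default \<infinity> agrees with \<open>E\<close> both outside \<open>C\<close> and
  at points of \<open>C\<close> where the limit is infinite.\<close>

lemma limit_functional_eqI:
  assumes lim: "\<And>f. f \<in> C \<Longrightarrow> ((\<lambda>l. F l f) \<longlongrightarrow> E f) (at_right 0)"
    and out: "\<And>f. f \<notin> C \<Longrightarrow> E f = \<infinity>"
  shows "limit_functional C F = E"
proof
  fix f
  show "limit_functional C F f = E f"
  proof (cases "f \<in> C \<and> (\<exists>c<\<infinity>. ((\<lambda>l. F l f) \<longlongrightarrow> c) (at_right 0))")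
    case True
    then show ?thesis
      unfolding limit_functional_def if_P[OF True]
      by (intro tendsto_Lim lim) auto
  next
    case False
    have "E f = \<infinity>"
    proof (rule ccontr)
      assume fin: "E f \<noteq> \<infinity>"
      then have "f \<in> C" using out by blast
      with False fin show False using lim by (metis ereal_infty_less(1))
    qed
    then show ?thesis unfolding limit_functional_def if_not_P[OF False] by simp
  qed
qed

lemma limit_cyclical_envelope:
  fixes C :: "'a::{real_inner, complete_space} set"
  assumes F_def: "F = (\<lambda>l. cyclical_envelope (approximant J l) f0)"
    and res: "nonexp_resolvent C J"
    and cyc: "\<forall>l>0. cyclically_monotone (\<lambda>f. f - J l f)"
    and bd: "Limsup (at_right 0) (\<lambda>l. ereal (norm ((1 / l) *\<^sub>R (f0 - J l f0)))) < \<infinity>"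
  shows "convex_lsc (limit_functional C F)"
    and "generated_by J (subdifferential (limit_functional C F))"
    and "\<forall>f\<in>C. ((\<lambda>l. F l f) \<longlongrightarrow> limit_functional C F f) (at_right 0)"
    and "eff_domain (limit_functional C F) \<subseteq> C"
proof -
  obtain E where E: "convex_lsc E" and J: "\<And>l. l > 0 \<Longrightarrow> J l = prox E l" and C: "C = closure (eff_domain E)"
    by (rule resolvent_eq_prox[OF res cyc]) blast
  interpret E: convex_lsc E by (rule E)
  obtain M :: real where "Limsup (at_right 0) (\<lambda>l. ereal (norm ((1 / l) *\<^sub>R (f0 - J l f0)))) < ereal M"
    using bd less_PInf_Ex_of_nat by (metis ereal_dense2)
  then have "eventually (\<lambda>l. ereal (norm ((1 / l) *\<^sub>R (f0 - J l f0))) < ereal M) (at_right 0)"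
    by (rule Limsup_lessD)
  moreover have "eventually (\<lambda>l. 0 < (l::real)) (at_right 0)" by (simp add: eventually_at_right_less)
  ultimately have "eventually (\<lambda>l. norm (approximant (prox E) l f0) \<le> M) (at_right 0)"
    by eventually_elim (simp add: approximant_def J)
  then have f0: "f0 \<in> E.D" by (rule E.bounded_approximant_imp_D)
  \<comment> \<open>Normalises the functional to vanish at \<open>f0\<close>, as the envelopes
    do.\<close>
  define c where "c = - E.e f0"
  have lim: "((\<lambda>l. F l f) \<longlongrightarrow> E f + ereal c) (at_right 0)" if "f \<in> C" for f
    using E.cyclical_envelope_tendsto[OF _ f0 J, of f] that by (simp add: C c_def F_def)
  have eq: "limit_functional C F = (\<lambda>f. E f + ereal c)"
  proof (rule limit_functional_eqI[OF lim])
    fix f assume "f \<notin> C"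
    then have "f \<notin> E.D" using C closure_subset by blast
    then show "E f + ereal c = \<infinity>" by (simp add: eff_domain_def)
  qed
  show "convex_lsc (limit_functional C F)" unfolding eq by (rule E.add_const)
  show "generated_by J (subdifferential (limit_functional C F))"
    unfolding eq E.add_const(3) E.generated_by_subdifferential_iff by (intro allI impI J)
  show "\<forall>f\<in>C. ((\<lambda>l. F l f) \<longlongrightarrow> limit_functional C F f) (at_right 0)"
    unfolding eq using lim by (rule ballI)
  show "eff_domain (limit_functional C F) \<subseteq> C"
    unfolding eq E.add_const(2) by (subst C) (rule closure_subset)
qed

theorem theorem3p19:
  shows
    "(\<forall>E :: 'a::{real_inner, complete_space} \<Rightarrow> ereal.
        (\<forall>f. E f \<noteq> -\<infinity>) \<and> convex_functional E \<and> proper_functional E \<and> lsc_functional E \<longrightarrow>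
          (\<forall>l>0. \<forall>f. \<exists>!g. is_arg_min (prox_objective E l f) (\<lambda>_. True) g) \<and>
          nonexp_resolvent (closure (eff_domain E)) (prox E) \<and>
          generated_by (prox E) (subdifferential E) \<and>
          (\<forall>l>0. cyclically_monotone (\<lambda>f. f - prox E l f)))
     \<and>
     (\<forall>(C :: 'a set) J f0.
        C \<noteq> {} \<and> closed C \<and> convex C \<and> nonexp_resolvent C J \<and>
        (\<forall>l>0. cyclically_monotone (\<lambda>f. f - J l f)) \<and>
        Limsup (at_right 0) (\<lambda>l. ereal (norm ((1 / l) *\<^sub>R (f0 - J l f0)))) < \<infinity> \<longrightarrow>
          (let F = (\<lambda>l. cyclical_envelope (approximant J l) f0);
               E = limit_functional C F
           in eff_domain E = {f \<in> C. \<exists>c<\<infinity>. ((\<lambda>l. F l f) \<longlongrightarrow> c) (at_right 0)} \<and>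
              (\<forall>f\<in>eff_domain E. ((\<lambda>l. F l f) \<longlongrightarrow> E f) (at_right 0)) \<and>
              (\<forall>f. E f \<noteq> -\<infinity>) \<and> proper_functional E \<and> convex_functional E \<and> lsc_functional E \<and>
              generated_by J (subdifferential E)))"
proof (intro conjI allI impI; (elim conjE)?)
  fix E :: "'a \<Rightarrow> ereal"
  assume "\<forall>f. E f \<noteq> -\<infinity>" "convex_functional E" "proper_functional E" "lsc_functional E"
  then interpret convex_lsc E by unfold_locales auto
  show "\<exists>!g. is_arg_min (prox_objective E l f) (\<lambda>_. True) g" if "l > 0" for l f
    by (rule ex1_is_arg_min_prox[OF that])
  show "nonexp_resolvent (closure (eff_domain E)) (prox E)" by (rule nonexp_resolvent_prox)
  show "generated_by (prox E) (subdifferential E)" by (simp add: generated_by_subdifferential_iff)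
  show "cyclically_monotone (\<lambda>f. f - prox E l f)" if "l > 0" for l
    by (rule prox_cyclically_monotone[OF that])
next
  fix C :: "'a set" and J f0
  assume res: "nonexp_resolvent C J" and cyc: "\<forall>l>0. cyclically_monotone (\<lambda>f. f - J l f)"
    and bd: "Limsup (at_right 0) (\<lambda>l. ereal (norm ((1 / l) *\<^sub>R (f0 - J l f0)))) < \<infinity>"
  define F where "F = (\<lambda>l. cyclical_envelope (approximant J l) f0)"
  note * = limit_cyclical_envelope[OF F_def res cyc bd]
  interpret L: convex_lsc "limit_functional C F" by (rule *(1))
  have dom: "eff_domain (limit_functional C F) = {f \<in> C. \<exists>c<\<infinity>. ((\<lambda>l. F l f) \<longlongrightarrow> c) (at_right 0)}"
  proof (intro equalityI subsetI)
    fix f assume "f \<in> eff_domain (limit_functional C F)"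
    then show "f \<in> {f \<in> C. \<exists>c<\<infinity>. ((\<lambda>l. F l f) \<longlongrightarrow> c) (at_right 0)}"
      using *(3,4) by (auto simp: eff_domain_def)
  next
    fix f assume "f \<in> {f \<in> C. \<exists>c<\<infinity>. ((\<lambda>l. F l f) \<longlongrightarrow> c) (at_right 0)}"
    then obtain c where c: "f \<in> C" "c < \<infinity>" "((\<lambda>l. F l f) \<longlongrightarrow> c) (at_right 0)" by blast
    have "limit_functional C F f = c" 
      by (rule tendsto_unique[OF _ *(3)[rule_format, OF c(1)] c(3)]) simp
    then show "f \<in> eff_domain (limit_functional C F)" using c(2) by (simp add: eff_domain_def)
  qed
  show "let F = (\<lambda>l. cyclical_envelope (approximant J l) f0);
               E = limit_functional C F
           in eff_domain E = {f \<in> C. \<exists>c<\<infinity>. ((\<lambda>l. F l f) \<longlongrightarrow> c) (at_right 0)} \<and>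
              (\<forall>f\<in>eff_domain E. ((\<lambda>l. F l f) \<longlongrightarrow> E f) (at_right 0)) \<and>
              (\<forall>f. E f \<noteq> -\<infinity>) \<and> proper_functional E \<and> convex_functional E \<and> lsc_functional E \<and>
              generated_by J (subdifferential E)"
    unfolding F_def[symmetric] Let_def
    using dom *(2-4) L.not_minf L.properE L.convexE L.lscE by blast
qed

end
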